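(* Let $d\ge 3$ be an odd integer and let $\lambda$ be a bar partition. Put $c=\bar c_d(\lambda)$ and $q=\bar q_d(\lambda)$. Then, as multisets, $$\mathcal{B}(\lambda)=\mathcal{B}(c)\cup\tilde{\mathcal{B}}(q),$$ where $$\tilde{\mathcal{B}}(q)=\Big(\overline{\mathcal{B}}(q)\setminus\big[\mathcal{P}(c)\cap\overline{\mathcal{P}}(q)\big]\Big)\cup\big[\mathcal{P}(c)\cap\overline{\mathcal{P}}(q)\big]^{\times 2}.$$
   Context: A bar partition is a partition into distinct parts $\mu=(a_1>a_2>\dots>a_m>0)$, with $m(\mu)=m$ and $|\mu|=\sum a_i$. Its multiset of bar lengths is $\mathcal{B}(\mu)=\bigcup_{1\le i\le m}\big(\{1,\dots,a_i\}\cup\{a_i+a_j\mid j>i\}\setminus\{a_i-a_j\mid j>i\}\big)$, and $\mathcal{P}(\mu)=\{a_1,\dots,a_m\}$ is its set of parts. Partition and multiset conventions: multiset union $\cup$ adds multiplicities, $\setminus$ is multiset difference, $\cap$ takes minimum multiplicities, and $A^{\times2}=\{2a\mid a\in A\}$ (with multiplicities). Young diagrams are drawn in English convention, with node $(r,c)$ in row $r$ and column $c$. For a partition $\nu$, $\nu'_c$ denotes the length of column $c$. The hook at node $(r,c)$ has length $h=\nu_r-c+\nu'_c-r+1$, hand node $(r,\nu_r)$ and foot node $(\nu'_c,c)$. The residue of node $(r,c)$ is $[c-r]_d$, the least non-negative integer congruent to $c-r$ mod $d$. For $0\le i,j\le d-1$, the set $H_{i\to j}(\nu)$ consists of the hooks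 of $\nu$ whose hand node has residue $i$ and whose foot node has residue $[j+1]_d$. The doubled partition $D(\mu)$ is the partition of $2|\mu|$ whose Frobenius symbol is $(a_1,\dots,a_m\mid a_1-1,\dots,a_m-1)$. Equivalently, for $1\le r\le m$, row $r$ has length $a_r+r$ and column $r$ has length $a_r+r-1$. Define two sets of hooks of $D(\mu)$: - $P(D(\mu))$ is the set of hooks at the nodes $(r,m+1)$, $1\le r\le m$; the hook in row $r$ has length $a_r$. - $B(D(\mu))$ is the set of hooks at the nodes $(r,c)$ with $1\le r\le m$, $r<c\le r+a_r$ and $c\ne m+1$. The lengths of the hooks in $P(D(\mu))\cup B(D(\mu))$ form exactly the multiset $\mathcal{B}(\mu)$. $d$-abacus: for a partition $\nu$, let $k$ be the least multiple of $d$ that is at least the number of nonzero parts of $\nu$. The minimally normalized $\beta$-set of $\nu$ is $X=\{\nu_s+k-s\mid 1\le s\le k\}$, and runner $i$ consists of the elements of $X$ congruent to $i$ mod $d$. The $d$-quotient of $\nu$ is the tuple of partitions whose $\beta$-sets are $\{(x-i)/d\mid x\in X,\ x\equiv i \bmod d\}$, $0\le i\le d-1$, computed with such a normalized $\beta$-set. The $d$-core is obtained by removing all hooks of length divisible by $d$. $\bar c_d(\lambda)$ is the $\bar d$-core of $\lambda$: it is obtained from $\lambda$ by removing all bars of length divisible by $d$, and it is the bar partition whose double $D(\bar c_d(\lambda))$ is the $d$-core of $D(\lambda)$. $\bar q_d(\lambda)$ is the $\bar d$-quotient partition: the unique bar partition $\mu$ such that $D(\mu)$ has empty $d$-core and the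 same $d$-quotient as $D(\lambda)$. Let $x_i$ be the number of beads on runner $i$ of the minimally normalized $d$-abacus of $D(\lambda)$. For a hook $z\in H_{i\to j}(D(q))$, its modified length is $\bar h(z)=h(z)+(x_i-x_j)d$. Then - $\overline{\mathcal{B}}(q)$ is the multiset $\{|\bar h(z)|\mid z\in P(D(q))\cup B(D(q))\}$; - $\overline{\mathcal{P}}(q)$ is the multiset $\{|\bar h(z)|\mid z\in P(D(q))\}$. *)

theory Defs
  imports Main "HOL-Library.Multiset"
begin

text \<open>Partitions are decreasing lists of positive integers; rows and columns are
  numbered from 1.\<close>

definition bar_partition :: "nat list \<Rightarrow> bool" where
  "bar_partition \<mu> \<longleftrightarrow> sorted_wrt (>) \<mu> \<and> 0 \<notin> set \<mu>"

definition row_len :: "nat list \<Rightarrow> nat \<Rightarrow> nat" where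
  "row_len \<nu> r = (if 1 \<le> r \<and> r \<le> length \<nu> then \<nu> ! (r - 1) else 0)"

definition col_len :: "nat list \<Rightarrow> nat \<Rightarrow> nat" where
  "col_len \<nu> c = card {r. 1 \<le> r \<and> r \<le> length \<nu> \<and> c \<le> row_len \<nu> r}"

definition young_diagram :: "nat list \<Rightarrow> (nat \<times> nat) set" where
  "young_diagram \<nu> = {(r, c). 1 \<le> r \<and> r \<le> length \<nu> \<and> 1 \<le> c \<and> c \<le> row_len \<nu> r}"


subsection \<open>Bar lengths\<close>

definition bar_lengths :: "nat list \<Rightarrow> nat multiset" where
  "bar_lengths \<mu> =
     (\<Sum>i = 1..length \<mu>.
        (mset_set {1..row_len \<mu> i} + {# row_len \<mu> i + row_len \<mu> j. j \<in># mset_set {i<..length \<mu>} #})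
        - {# row_len \<mu> i - row_len \<mu> j. j \<in># mset_set {i<..length \<mu>} #})"

definition parts :: "nat list \<Rightarrow> nat multiset" where
  "parts \<mu> = mset_set (set \<mu>)"

text \<open>Removal of a bar of length \<open>b\<close>: delete a part \<open>b\<close>, or replace a part \<open>a > b\<close> by
  \<open>a - b\<close> if the latter is not yet a part, or delete two distinct parts with sum \<open>b\<close>.\<close>

definition bar_removal :: "nat \<Rightarrow> nat list \<Rightarrow> nat list \<Rightarrow> bool" where
  "bar_removal b \<mu> \<mu>' \<longleftrightarrow> bar_partition \<mu>' \<and> 0 < b \<and>
     ((b \<in> set \<mu> \<and> set \<mu>' = set \<mu> - {b}) \<or>
      (\<exists>a \<in> set \<mu>. b < a \<and> a - b \<notin> set \<mu> \<and> set \<mu>' = insert (a - b) (set \<mu> - {a})) \<or>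
      (\<exists>a \<in> set \<mu>. \<exists>a' \<in> set \<mu>. a \<noteq> a' \<and> b = a + a' \<and> set \<mu>' = set \<mu> - {a, a'}))"

definition bar_core :: "nat \<Rightarrow> nat list \<Rightarrow> nat list" where
  "bar_core d \<mu> = (THE \<kappa>.
     (\<lambda>\<mu>1 \<mu>2. \<exists>b. d dvd b \<and> bar_removal b \<mu>1 \<mu>2)\<^sup>*\<^sup>* \<mu> \<kappa> \<and>
     (\<forall>b \<in># bar_lengths \<kappa>. \<not> d dvd b))"


subsection \<open>Hooks, represented by their corner node\<close>

definition hook_length :: "nat list \<Rightarrow> nat \<times> nat \<Rightarrow> nat" where
  "hook_length \<nu> = (\<lambda>(r, c). (row_len \<nu> r - c) + (col_len \<nu> c - r) + 1)"

definition hand_node :: "nat list \<Rightarrow> nat \<times> nat \<Rightarrow> nat \<times> nat" where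
  "hand_node \<nu> = (\<lambda>(r, c). (r, row_len \<nu> r))"

definition foot_node :: "nat list \<Rightarrow> nat \<times> nat \<Rightarrow> nat \<times> nat" where
  "foot_node \<nu> = (\<lambda>(r, c). (col_len \<nu> c, c))"

definition residue :: "nat \<Rightarrow> nat \<times> nat \<Rightarrow> nat" where
  "residue d = (\<lambda>(r, c). nat ((int c - int r) mod int d))"

definition hooks_from_to :: "nat \<Rightarrow> nat \<Rightarrow> nat \<Rightarrow> nat list \<Rightarrow> (nat \<times> nat) set" where
  "hooks_from_to d i j \<nu> = {z \<in> young_diagram \<nu>.
     residue d (hand_node \<nu> z) = i \<and> residue d (foot_node \<nu> z) = (j + 1) mod d}"

text \<open>Removing a hook means removing the rim hook running from its hand node to its foot node:
  the rows above the foot row are replaced by the next row shortened by one node.\<close>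

definition remove_hook :: "nat list \<Rightarrow> nat \<times> nat \<Rightarrow> nat list" where
  "remove_hook \<nu> = (\<lambda>(r, c). filter (\<lambda>x. 0 < x)
     (map (\<lambda>i. if r \<le> i \<and> i < col_len \<nu> c then row_len \<nu> (i + 1) - 1
               else if i = col_len \<nu> c then c - 1
               else row_len \<nu> i) [1..<length \<nu> + 1]))"

definition hook_core :: "nat \<Rightarrow> nat list \<Rightarrow> nat list" where
  "hook_core d \<nu> = (THE \<kappa>.
     (\<lambda>\<nu>1 \<nu>2. \<exists>z \<in> young_diagram \<nu>1. d dvd hook_length \<nu>1 z \<and> \<nu>2 = remove_hook \<nu>1 z)\<^sup>*\<^sup>* \<nu> \<kappa> \<and>
     (\<forall>z \<in> young_diagram \<kappa>. \<not> d dvd hook_length \<kappa> z))"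


subsection \<open>The doubled partition\<close>

text \<open>The partition with Frobenius symbol \<open>(\<alpha> | \<beta>)\<close>: for \<open>r \<le> length \<alpha>\<close>, row \<open>r\<close> has
  length \<open>\<alpha>\<^sub>r + r\<close> and column \<open>r\<close> has length \<open>\<beta>\<^sub>r + r\<close>; the lower rows are read off
  from the columns.\<close>

definition partition_of_frobenius :: "nat list \<Rightarrow> nat list \<Rightarrow> nat list" where
  "partition_of_frobenius \<alpha> \<beta> =
     (if \<alpha> = [] then [] else
      map (\<lambda>r. if r \<le> length \<alpha> then row_len \<alpha> r + r
               else card {c. 1 \<le> c \<and> c \<le> length \<alpha> \<and> r \<le> row_len \<beta> c + c}) [1..<hd \<beta> + 2])"

definition doubled :: "nat list \<Rightarrow> nat list" where
  "doubled \<mu> = partition_of_frobenius \<mu> (map (\<lambda>a. a - 1) \<mu>)"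

lemma bar_partition_row_len:
  assumes "bar_partition \<mu>" and "1 \<le> r" and "r \<le> s" and "s \<le> length \<mu>"
  shows "row_len \<mu> s + s \<le> row_len \<mu> r + r" and "length \<mu> < row_len \<mu> r + r"
proof -
  have less: "row_len \<mu> (Suc t) < row_len \<mu> t" if "1 \<le> t" "Suc t \<le> length \<mu>" for t
    using assms(1) that unfolding bar_partition_def row_len_def
    by (auto simp: sorted_wrt_iff_nth_less)
  have mono: "row_len \<mu> t + t \<le> row_len \<mu> r + r" if "r \<le> t" "t \<le> length \<mu>" for t
    using that
  proof (induction t rule: dec_induct)
    case (step t)
    then show ?case using less[of t] assms(2)
      by linarith
  qed simp
  show "row_len \<mu> s + s \<le> row_len \<mu> r + r"
    using mono assms by simp
  have "row_len \<mu> (length \<mu>) \<in> set \<mu>"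
    using assms unfolding row_len_def by auto
  then have "0 < row_len \<mu> (length \<mu>)"
    using assms(1) unfolding bar_partition_def by (metis gr0I)
  then show "length \<mu> < row_len \<mu> r + r"
    using mono[of "length \<mu>"] assms by linarith
qed

lemma doubled_row_col:
  assumes "bar_partition \<mu>" and "1 \<le> r" and "r \<le> length \<mu>"
  shows "row_len (doubled \<mu>) r = row_len \<mu> r + r"
    and "col_len (doubled \<mu>) r = row_len \<mu> r + r - 1"
proof -
  let ?m = "length \<mu>"
  let ?b = "map (\<lambda>a. a - 1) \<mu>"
  let ?L = "row_len \<mu> 1"
  have ne: "\<mu> \<noteq> []" using assms by auto
  have b: "row_len ?b c + c = row_len \<mu> c + c - 1" if "1 \<le> c" "c \<le> ?m" for c
  proof -
    have "\<mu> ! (c - 1) \<in> set \<mu>" using that by simp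
    then have "\<mu> ! (c - 1) \<noteq> 0"
      using assms(1) unfolding bar_partition_def by metis
    then show ?thesis using that unfolding row_len_def by simp
  qed
  have L: "0 < ?L" "?m \<le> ?L"
    using bar_partition_row_len[OF assms(1), of 1 1] ne by (cases \<mu>; simp)+
  have "hd ?b + 2 = ?L + 1"
    using ne L(1) by (cases \<mu>) (auto simp: row_len_def)
  then have D: "doubled \<mu> = map (\<lambda>s. if s \<le> ?m then row_len \<mu> s + s
      else card {c. 1 \<le> c \<and> c \<le> ?m \<and> s \<le> row_len ?b c + c}) [1..<?L + 1]"
    using ne unfolding doubled_def partition_of_frobenius_def by simp
  have len: "length (doubled \<mu>) = ?L" unfolding D by simp
  have row: "row_len (doubled \<mu>) s = (if s \<le> ?m then row_len \<mu> s + s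
      else card {c. 1 \<le> c \<and> c \<le> ?m \<and> s \<le> row_len ?b c + c})" if "1 \<le> s" "s \<le> ?L" for s
    using that unfolding row_len_def[of "doubled \<mu>"] len unfolding D
    by (simp del: upt_Suc add: nth_append)
  show "row_len (doubled \<mu>) r = row_len \<mu> r + r"
    using row[of r] assms L by simp
  have low: "r \<le> card {c. 1 \<le> c \<and> c \<le> ?m \<and> s \<le> row_len ?b c + c} \<longleftrightarrow> s \<le> row_len \<mu> r + r - 1"
    (is "r \<le> card ?C \<longleftrightarrow> _") for s
  proof
    assume a: "s \<le> row_len \<mu> r + r - 1"
    have "{1..r} \<subseteq> ?C"
    proof
      fix c assume c: "c \<in> {1..r}"
      then have "row_len \<mu> r + r \<le> row_len \<mu> c + c"
        using bar_partition_row_len(1)[OF assms(1), of c r] assms by simp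
      then show "c \<in> ?C" using c a b[of c] assms by simp
    qed
    then have "card {1..r} \<le> card ?C" by (intro card_mono) auto
    then show "r \<le> card ?C" by simp
  next
    assume a: "r \<le> card ?C"
    show "s \<le> row_len \<mu> r + r - 1"
    proof (rule ccontr)
      assume n: "\<not> ?thesis"
      have "?C \<subseteq> {1..<r}"
      proof
        fix c assume c: "c \<in> ?C"
        show "c \<in> {1..<r}"
        proof (rule ccontr)
          assume "c \<notin> {1..<r}"
          then have "row_len \<mu> c + c \<le> row_len \<mu> r + r"
            using bar_partition_row_len(1)[OF assms(1), of r c] assms c by simp
          then show False using n c b[of c] by (simp, linarith)
        qed
      qed
      then have "card ?C \<le> card {1..<r}" by (intro card_mono) auto
      then show False using a assms(2) by simp
    qed
  qed
  have up: "r \<le> row_len \<mu> s + s" if "1 \<le> s" "s \<le> ?m" for s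
    using bar_partition_row_len(2)[OF assms(1), of s s] that assms(3) by simp
  have le: "row_len \<mu> r + r - 1 \<le> ?L" "?m \<le> row_len \<mu> r + r - 1"
    using bar_partition_row_len(1)[OF assms(1), of 1 r] bar_partition_row_len(2)[OF assms(1), of r r]
      assms by simp_all
  have "{s. 1 \<le> s \<and> s \<le> length (doubled \<mu>) \<and> r \<le> row_len (doubled \<mu>) s} = {1..row_len \<mu> r + r - 1}"
    (is "?A = ?B")
  proof (rule set_eqI)
    fix s
    show "s \<in> ?A \<longleftrightarrow> s \<in> ?B"
      using row[of s] low[of s] up[of s] le len by (cases "s \<le> ?m") auto
  qed
  then show "col_len (doubled \<mu>) r = row_len \<mu> r + r - 1"
    unfolding col_len_def by simp
qed

definition part_hooks :: "nat list \<Rightarrow> (nat \<times> nat) set" where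
  "part_hooks \<mu> = {(r, c). 1 \<le> r \<and> r \<le> length \<mu> \<and> c = length \<mu> + 1}"

definition other_bar_hooks :: "nat list \<Rightarrow> (nat \<times> nat) set" where
  "other_bar_hooks \<mu> = {(r, c). 1 \<le> r \<and> r \<le> length \<mu> \<and>
     r < c \<and> c \<le> r + row_len \<mu> r \<and> c \<noteq> length \<mu> + 1}"


subsection \<open>Abacus and quotient\<close>

definition beta_set :: "nat \<Rightarrow> nat list \<Rightarrow> nat set" where
  "beta_set d \<nu> = (let k = (LEAST k. d dvd k \<and> length \<nu> \<le> k)
                   in {row_len \<nu> s + k - s | s. 1 \<le> s \<and> s \<le> k})"

definition runner :: "nat \<Rightarrow> nat list \<Rightarrow> nat \<Rightarrow> nat set" where
  "runner d \<nu> i = {x \<in> beta_set d \<nu>. x mod d = i}"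

text \<open>The partition with \<open>\<beta>\<close>-set \<open>X\<close>: a bead at \<open>x\<close> contributes a part equal to the number
  of empty positions below it.\<close>

definition partition_of_beta_set :: "nat set \<Rightarrow> nat list" where
  "partition_of_beta_set X = filter (\<lambda>p. 0 < p)
     (map (\<lambda>x. x - card {y \<in> X. y < x}) (rev (sorted_list_of_set X)))"

definition quotient :: "nat \<Rightarrow> nat list \<Rightarrow> nat list list" where
  "quotient d \<nu> =
     map (\<lambda>i. partition_of_beta_set ((\<lambda>x. (x - i) div d) ` runner d \<nu> i)) [0..<d]"

definition bar_quotient :: "nat \<Rightarrow> nat list \<Rightarrow> nat list" where
  "bar_quotient d lam = (THE \<mu>. bar_partition \<mu> \<and> hook_core d (doubled \<mu>) = [] \<and>
     quotient d (doubled \<mu>) = quotient d (doubled lam))"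


subsection \<open>Modified bar lengths\<close>

text \<open>The hook \<open>z\<close> lies in \<open>hooks_from_to d i j (doubled q)\<close> for exactly the \<open>i\<close> and \<open>j\<close>
  used here; the bead numbers are those of \<open>doubled lam\<close>.\<close>

definition modified_length :: "nat \<Rightarrow> nat list \<Rightarrow> nat list \<Rightarrow> nat \<times> nat \<Rightarrow> int" where
  "modified_length d lam q z =
     (let i = residue d (hand_node (doubled q) z);
          j = nat ((int (residue d (foot_node (doubled q) z)) - 1) mod int d);
          x = (\<lambda>i. int (card (runner d (doubled lam) i)))
      in int (hook_length (doubled q) z) + (x i - x j) * int d)"

lemma modified_length_hooks_from_to:
  assumes "z \<in> hooks_from_to d i j (doubled q)" and "i < d" and "j < d"
  shows "modified_length d lam q z = int (hook_length (doubled q) z) +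
    (int (card (runner d (doubled lam) i)) - int (card (runner d (doubled lam) j))) * int d"
proof -
  have "(int ((j + 1) mod d) - 1) mod int d = int j mod int d"
    by (simp add: zmod_int mod_diff_left_eq)
  then have "nat ((int ((j + 1) mod d) - 1) mod int d) = j"
    using assms(3) by simp
  then show ?thesis
    using assms(1) unfolding modified_length_def hooks_from_to_def Let_def by auto
qed

definition modified_bar_lengths :: "nat \<Rightarrow> nat list \<Rightarrow> nat list \<Rightarrow> nat multiset" where
  "modified_bar_lengths d lam q =
     {# nat \<bar>modified_length d lam q z\<bar>. z \<in># mset_set (part_hooks q \<union> other_bar_hooks q) #}"

definition modified_parts :: "nat \<Rightarrow> nat list \<Rightarrow> nat list \<Rightarrow> nat multiset" where
  "modified_parts d lam q =
     {# nat \<bar>modified_length d lam q z\<bar>. z \<in># mset_set (part_hooks q) #}"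

definition tilde_bar_lengths :: "nat \<Rightarrow> nat list \<Rightarrow> nat list \<Rightarrow> nat list \<Rightarrow> nat multiset" where
  "tilde_bar_lengths d lam c q =
     (modified_bar_lengths d lam q - (parts c \<inter># modified_parts d lam q))
     + {# 2 * a. a \<in># parts c \<inter># modified_parts d lam q #}"

end

theory Submission
  imports Defs
begin

text \<open>
  Encode a bar partition with set of parts \<open>A\<close> by the set \<open>M\<close> of integers consisting of \<open>A\<close> and
  of all negative integers \<open>-n\<close> with \<open>n \<notin> A\<close>. This is the Maya diagram \<open>{\<nu>\<^sub>s - s | s \<ge> 1}\<close> of the
  doubled partition \<open>\<nu>\<close>. Hooks of \<open>\<nu>\<close> are the pairs \<open>(x, y)\<close> with \<open>x \<in> M\<close>, \<open>y \<notin> M\<close>, \<open>y < x\<close>, of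
  length \<open>x - y\<close>, and the bars are those with \<open>\<bar>y\<bar> < x\<close>; the parts are the bars with \<open>y = 0\<close>.

  Let \<open>t x\<close> be the charge of the residue class of \<open>x\<close> in the diagram \<open>M\<close> of \<open>lam\<close> and
  \<open>\<phi> x = x + d * t x\<close>. Then \<open>\<phi>\<close> is a permutation of the integers commuting with negation, which carries the diagram \<open>S\<close>
  of the bar quotient to \<open>M\<close> and the negative integers to the diagram of the bar core, and the
  modified length of the hook \<open>(x, y)\<close> of the quotient is \<open>\<phi> x - \<phi> y\<close>.

  Three identities then give the theorem. Because every class of \<open>S\<close> has charge zero, the hook
  lengths of \<open>M\<close> are those of the core together with the numbers \<open>\<bar>\<phi> x - \<phi> y\<bar>\<close>, \<open>(x, y)\<close> a hook of \<open>S\<close>.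
  The involution \<open>(x, y) \<mapsto> (-y, -x)\<close> shows, for \<open>lam\<close>, the core and the quotient alike, that
  hooks + parts = 2 bars + doubled parts. Finally the set of parts of \<open>lam\<close> is the symmetric
  difference of the parts of the core and the modified parts of the quotient.
\<close>

section \<open>Maya diagrams and their charges\<close>

text \<open>One bound \<open>N\<close> serves both ends. It makes both counts in
  \<open>charge\<close> and the set of hooks finite.\<close>

definition maya_set :: "int set \<Rightarrow> bool" where
  "maya_set S \<longleftrightarrow> (\<exists>N. \<forall>x. (N \<le> x \<longrightarrow> x \<notin> S) \<and> (x < -N \<longrightarrow> x \<in> S))"

text \<open>The index \<open>i\<close> may be any representative of its residue class, not only the reduced one.\<close>

definition charge :: "int \<Rightarrow> int set \<Rightarrow> int \<Rightarrow> int" where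
  "charge d S i = int (card {x \<in> S. 0 \<le> x \<and> x mod d = i mod d})
     - int (card {x. x \<notin> S \<and> x < 0 \<and> x mod d = i mod d})"

definition hook_pairs :: "int set \<Rightarrow> (int \<times> int) set" where
  "hook_pairs S = {(x, y). x \<in> S \<and> y \<notin> S \<and> y < x}"

definition bar_pairs :: "int set \<Rightarrow> (int \<times> int) set" where
  "bar_pairs S = {(x, y). x \<in> S \<and> y \<notin> S \<and> \<bar>y\<bar> < x}"

text \<open>Negation interchanges beads and gaps. Its fixed point 0 needs a convention of its own;
  calling it a gap matches Frobenius symbols of the form (a | a - 1).\<close>

definition bar_symmetric :: "int set \<Rightarrow> bool" where
  "bar_symmetric S \<longleftrightarrow> 0 \<notin> S \<and> (\<forall>x. x \<noteq> 0 \<longrightarrow> (x \<in> S \<longleftrightarrow> - x \<notin> S))"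

text \<open>The absolute value is there because \<phi> may reverse the order of a pair. As
  \<open>mset_set\<close> of an infinite set is empty, the definition is meaningful only for finite
  \<open>W\<close>.\<close>

definition pair_lengths :: "(int \<Rightarrow> int) \<Rightarrow> (int \<times> int) set \<Rightarrow> nat multiset" where
  "pair_lengths \<phi> W = {# nat \<bar>\<phi> x - \<phi> y\<bar>. (x, y) \<in># mset_set W #}"

section \<open>Finiteness of the sets attached to a diagram\<close>

lemma count_image_mset_set:
  "finite A \<Longrightarrow> count (image_mset f (mset_set A)) n = card {a \<in> A. f a = n}"
proof (induction A rule: finite_induct)
  case (insert a A)
  have "{b \<in> insert a A. f b = n} = (if f a = n then insert a {b \<in> A. f b = n} else {b \<in> A. f b = n})"
    by auto
  then show ?case using insert by simp
qed simp

lemma finite_maya_nonneg: "maya_set S \<Longrightarrow> finite {x \<in> S. 0 \<le> x \<and> P x}"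
  unfolding maya_set_def
proof (elim exE)
  fix N assume N: "\<forall>x. (N \<le> x \<longrightarrow> x \<notin> S) \<and> (x < -N \<longrightarrow> x \<in> S)"
  have "x < N" if "x \<in> S" for x using N that by (metis not_le)
  then have "{x \<in> S. 0 \<le> x \<and> P x} \<subseteq> {0..N}" by force
  then show ?thesis by (rule finite_subset) simp
qed

lemma finite_maya_gaps: "maya_set S \<Longrightarrow> finite {x. x \<notin> S \<and> x < 0 \<and> P x}"
  unfolding maya_set_def
proof (elim exE)
  fix N assume N: "\<forall>x. (N \<le> x \<longrightarrow> x \<notin> S) \<and> (x < -N \<longrightarrow> x \<in> S)"
  have "-N \<le> x" if "x \<notin> S" for x using N that by (metis not_le)
  then have "{x. x \<notin> S \<and> x < 0 \<and> P x} \<subseteq> {-N..0}" by auto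
  then show ?thesis by (rule finite_subset) simp
qed

lemma finite_hook_pairs: "maya_set S \<Longrightarrow> finite (hook_pairs S)"
  unfolding maya_set_def
proof (elim exE)
  fix N assume N: "\<forall>x. (N \<le> x \<longrightarrow> x \<notin> S) \<and> (x < -N \<longrightarrow> x \<in> S)"
  have "hook_pairs S \<subseteq> {-N..N} \<times> {-N..N}"
  proof
    fix z assume "z \<in> hook_pairs S"
    then obtain x y where z: "z = (x, y)" "x \<in> S" "y \<notin> S" "y < x" by (auto simp: hook_pairs_def)
    have "x < N" "-N \<le> y" using N z by (metis not_le)+
    then show "z \<in> {-N..N} \<times> {-N..N}" using z by simp
  qed
  then show ?thesis by (rule finite_subset) simp
qed

lemma bar_pairs_subset: "bar_pairs S \<subseteq> hook_pairs S"
  by (auto simp: bar_pairs_def hook_pairs_def)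

lemma maya_set_lessThan [simp]: "maya_set {..<0}"
  unfolding maya_set_def by (rule exI[of _ 0]) auto

lemma maya_set_remove: "maya_set S \<Longrightarrow> maya_set (S - {x})"
  unfolding maya_set_def
proof (elim exE)
  fix N assume N: "\<forall>x. (N \<le> x \<longrightarrow> x \<notin> S) \<and> (x < -N \<longrightarrow> x \<in> S)"
  show "\<exists>N. \<forall>y. (N \<le> y \<longrightarrow> y \<notin> S - {x}) \<and> (y < -N \<longrightarrow> y \<in> S - {x})"
    by (rule exI[of _ "max N (-x)"]) (use N in auto)
qed

section \<open>Charge under insertion, removal and shifting of beads\<close>

lemma charge_cong: "i mod d = j mod d \<Longrightarrow> charge d S i = charge d S j"
  unfolding charge_def by simp

lemma charge_add_mult [simp]: "charge d S (i + d * k) = charge d S i" "charge d S (i + k * d) = charge d S i"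
  by (rule charge_cong; simp)+

text \<open>A new bead at or above 0 enters the first count of the charge, and one below 0 fills a
  gap of the second count. Both raise the charge of its class by one.\<close>

lemma charge_insert:
  assumes "maya_set S" "x \<notin> S"
  shows "charge d (insert x S) i = charge d S i + of_bool (x mod d = i mod d)"
proof (cases "x mod d = i mod d")
  case False
  have "{y \<in> insert x S. 0 \<le> y \<and> y mod d = i mod d} = {y \<in> S. 0 \<le> y \<and> y mod d = i mod d}"
    "{y. y \<notin> insert x S \<and> y < 0 \<and> y mod d = i mod d} = {y. y \<notin> S \<and> y < 0 \<and> y mod d = i mod d}"
    using False by auto
  then show ?thesis using False unfolding charge_def by simp
next
  case True
  note fin = finite_maya_nonneg[OF assms(1), of "\<lambda>y. y mod d = i mod d"]
    finite_maya_gaps[OF assms(1), of "\<lambda>y. y mod d = i mod d"]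
  show ?thesis
  proof (cases "0 \<le> x")
    case T2: True
    have "{y \<in> insert x S. 0 \<le> y \<and> y mod d = i mod d} = insert x {y \<in> S. 0 \<le> y \<and> y mod d = i mod d}"
      "{y. y \<notin> insert x S \<and> y < 0 \<and> y mod d = i mod d} = {y. y \<notin> S \<and> y < 0 \<and> y mod d = i mod d}"
      using True T2 by auto
    then show ?thesis using True assms fin unfolding charge_def by simp
  next
    case F2: False
    have a: "{y \<in> insert x S. 0 \<le> y \<and> y mod d = i mod d} = {y \<in> S. 0 \<le> y \<and> y mod d = i mod d}"
      "{y. y \<notin> S \<and> y < 0 \<and> y mod d = i mod d} = insert x {y. y \<notin> insert x S \<and> y < 0 \<and> y mod d = i mod d}"
      using True F2 assms by auto
    have "finite {y. y \<notin> insert x S \<and> y < 0 \<and> y mod d = i mod d}"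
      by (rule finite_subset[OF _ fin(2)]) auto
    then show ?thesis using True unfolding charge_def a by simp
  qed
qed

lemma charge_remove:
  assumes "maya_set S" "x \<in> S"
  shows "charge d (S - {x}) i = charge d S i - of_bool (x mod d = i mod d)"
  using charge_insert[OF maya_set_remove[OF assms(1), of x], of x d i] assms(2)
  by (simp add: insert_absorb)

lemma charge_move:
  assumes "maya_set S" "x \<in> S" "y \<notin> S" "x mod d = y mod d"
  shows "charge d (insert y (S - {x})) i = charge d S i"
  using charge_insert[OF maya_set_remove[OF assms(1)], of y x d i] charge_remove[OF assms(1,2), of d i] assms
  by simp

lemma maya_set_shift_uniform:
  "maya_set S \<Longrightarrow> maya_set {x. x + c \<in> S}"
  unfolding maya_set_def
proof (elim exE)
  fix N assume N: "\<forall>x. (N \<le> x \<longrightarrow> x \<notin> S) \<and> (x < -N \<longrightarrow> x \<in> S)"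
  show "\<exists>N. \<forall>y. (N \<le> y \<longrightarrow> y \<notin> {x. x + c \<in> S}) \<and> (y < -N \<longrightarrow> y \<in> {x. x + c \<in> S})"
    by (rule exI[of _ "N + \<bar>c\<bar>"]) (use N in auto)
qed

text \<open>All beads move down by \<open>d\<close>. In each class exactly one position crosses the
  origin, the reduced residue \<open>r\<close>: a bead there leaves the first count, a gap there
  joins the second.\<close>

lemma charge_shift_one:
  assumes "maya_set S" "0 < d"
  shows "charge d {x. x + d \<in> S} i = charge d S i - 1"
proof -
  define r where "r = i mod d"
  have r: "0 \<le> r" "r < d" "r mod d = r" using assms(2) by (auto simp: r_def)
  let ?f = "\<lambda>x. x + d"
  let ?P = "{x. x + d \<in> S \<and> 0 \<le> x \<and> x mod d = r}"
  let ?G = "{x. x + d \<notin> S \<and> x < 0 \<and> x mod d = r}"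
  note fin = finite_maya_nonneg[OF assms(1), of "\<lambda>y. y mod d = r"]
    finite_maya_gaps[OF assms(1), of "\<lambda>y. y mod d = r"]
  have small: "x = r" if "0 \<le> x" "x < d" "x mod d = r" for x using that by simp
  have P: "?f ` ?P = {x \<in> S. 0 \<le> x \<and> x mod d = r} - {r}"
  proof (intro set_eqI iffI)
    fix x assume "x \<in> {x \<in> S. 0 \<le> x \<and> x mod d = r} - {r}"
    then have "x - d \<in> ?P" using small[of x] by (auto simp: not_less[symmetric])
    then have "?f (x - d) \<in> ?f ` ?P" by blast
    then show "x \<in> ?f ` ?P" by simp
  qed (use r in auto)
  have G: "?f ` ?G = {x. x \<notin> S \<and> x < 0 \<and> x mod d = r} \<union> (if r \<in> S then {} else {r})"
  proof (intro set_eqI iffI)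
    fix x assume x: "x \<in> {x. x \<notin> S \<and> x < 0 \<and> x mod d = r} \<union> (if r \<in> S then {} else {r})"
    have "x - d \<in> ?G" using x r assms(2) by (auto split: if_splits)
    then have "?f (x - d) \<in> ?f ` ?G" by blast
    then show "x \<in> ?f ` ?G" by simp
  next
    fix x assume "x \<in> ?f ` ?G"
    then have "x \<notin> S" "x < d" "x mod d = r" by auto
    then show "x \<in> {x. x \<notin> S \<and> x < 0 \<and> x mod d = r} \<union> (if r \<in> S then {} else {r})"
      using small[of x] by (cases "x < 0") auto
  qed
  have cP: "card (?f ` ?P) = card ?P" and cG: "card (?f ` ?G) = card ?G"
    by (rule card_image; simp add: inj_on_def)+
  have "int (card ?P) = int (card {x \<in> S. 0 \<le> x \<and> x mod d = r}) - of_bool (r \<in> S)"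
  proof (cases "r \<in> S")
    case True
    then have "r \<in> {x \<in> S. 0 \<le> x \<and> x mod d = r}" using r by blast
    then have "card {x \<in> S. 0 \<le> x \<and> x mod d = r} = Suc (card ({x \<in> S. 0 \<le> x \<and> x mod d = r} - {r}))"
      by (rule card.remove[OF fin(1)])
    moreover have "of_bool (r \<in> S) = (1::int)" using True by simp
    ultimately show ?thesis unfolding cP[symmetric] P by linarith
  next
    case False
    then have "{x \<in> S. 0 \<le> x \<and> x mod d = r} - {r} = {x \<in> S. 0 \<le> x \<and> x mod d = r}" by blast
    moreover have "of_bool (r \<in> S) = (0::int)" using False by simp
    ultimately show ?thesis unfolding cP[symmetric] P by (simp only: diff_0_right)
  qed
  moreover have "int (card ?G) = int (card {x. x \<notin> S \<and> x < 0 \<and> x mod d = r}) + of_bool (r \<notin> S)"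
  proof (cases "r \<in> S")
    case False
    have "r \<notin> {x. x \<notin> S \<and> x < 0 \<and> x mod d = r}" using r by auto
    then have "card (insert r {x. x \<notin> S \<and> x < 0 \<and> x mod d = r}) = Suc (card {x. x \<notin> S \<and> x < 0 \<and> x mod d = r})"
      by (rule card_insert_disjoint[OF fin(2)])
    then show ?thesis using False unfolding cG[symmetric] G by simp
  qed (simp add: cG[symmetric] G)
  ultimately show ?thesis unfolding charge_def r_def[symmetric] by (simp add: of_bool_def)
qed

lemma charge_shift_uniform:
  assumes "maya_set S" "0 < d"
  shows "charge d {x. x + d * k \<in> S} i = charge d S i - k"
proof (induction k rule: int_induct[where k = 0])
  case (step1 k)
  have "{x. x + d * (k + 1) \<in> S} = {x. x + d \<in> {x. x + d * k \<in> S}}" by (simp add: algebra_simps)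
  then show ?case
    using charge_shift_one[OF maya_set_shift_uniform[OF assms(1)] assms(2), of "d * k" i] step1 by simp
next
  case (step2 k)
  have "{x. x + d * k \<in> S} = {x. x + d \<in> {x. x + d * (k - 1) \<in> S}}" by (simp add: algebra_simps)
  then show ?case
    using charge_shift_one[OF maya_set_shift_uniform[OF assms(1)] assms(2), of "d * (k - 1)" i] step2
    by simp
qed simp

lemma charge_local:
  assumes "\<And>x. x mod d = i mod d \<Longrightarrow> x \<in> S \<longleftrightarrow> x \<in> T"
  shows "charge d S i = charge d T i"
proof -
  have "{x \<in> S. 0 \<le> x \<and> x mod d = i mod d} = {x \<in> T. 0 \<le> x \<and> x mod d = i mod d}"
    "{x. x \<notin> S \<and> x < 0 \<and> x mod d = i mod d} = {x. x \<notin> T \<and> x < 0 \<and> x mod d = i mod d}"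
    using assms by auto
  then show ?thesis unfolding charge_def by simp
qed

text \<open>Slides the beads of each residue class so that its charge becomes zero.\<close>

definition normalized :: "int \<Rightarrow> int set \<Rightarrow> int set" where
  "normalized d S = {x. x + d * charge d S x \<in> S}"

text \<open>The charge depends on one residue class only, and on that class normalizing is a uniform
  shift by \<open>d\<close> times the charge.\<close>

lemma charge_normalized:
  assumes "maya_set S" "0 < d"
  shows "charge d (normalized d S) i = 0"
proof -
  have "charge d (normalized d S) i = charge d {x. x + d * charge d S i \<in> S} i"
  proof (rule charge_local)
    fix x assume "x mod d = i mod d"
    then have "charge d S x = charge d S i" by (rule charge_cong)
    then show "x \<in> normalized d S \<longleftrightarrow> x \<in> {x. x + d * charge d S i \<in> S}" by (simp add: normalized_def)
  qed
  then show ?thesis using charge_shift_uniform[OF assms] by simp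
qed

text \<open>Shifting by a multiple of \<open>d\<close> stays in the residue class, where the charge
  of \<open>S\<close> is constant; hence the shift is invertible and undoes the
  normalization.\<close>

lemma image_shift_normalized:
  "(\<lambda>x. x + d * charge d S x) ` normalized d S = S"
proof (intro set_eqI iffI)
  fix x assume "x \<in> S"
  then have "x - d * charge d S x \<in> normalized d S"
    using charge_add_mult(1)[of d S x "- charge d S x"] by (simp add: normalized_def)
  moreover have "x = (\<lambda>x. x + d * charge d S x) (x - d * charge d S x)"
    using charge_add_mult(1)[of d S x "- charge d S x"] by simp
  ultimately show "x \<in> (\<lambda>x. x + d * charge d S x) ` normalized d S" by (rule rev_image_eqI)
qed (auto simp: normalized_def)

text \<open>Without hooks of length divisible by \<open>d\<close>, every class consists of beads up
  to some point and of gaps beyond it. Charge zero puts this point at 0.\<close>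

lemma flush_normalized:
  assumes "maya_set S" "0 < d" and flush: "\<And>x y. x \<in> S \<Longrightarrow> y \<notin> S \<Longrightarrow> y < x \<Longrightarrow> \<not> d dvd x - y"
  shows "normalized d S = {..<0}"
proof -
  let ?N = "normalized d S"
  have flushN: "False" if "x \<in> ?N" "y \<notin> ?N" "y < x" "x mod d = y mod d" for x y
    using that flush[of "x + d * charge d S x" "y + d * charge d S y"] charge_cong[of x d y S]
    by (simp add: normalized_def mod_eq_dvd_iff)
  \<comment> \<open>A cardinality of 0 means emptiness only for finite sets. Finiteness comes from
    the uniform shift that \<open>normalized\<close> is on a single class.\<close>
  have fin: "finite {x \<in> ?N. 0 \<le> x \<and> x mod d = i mod d}" "finite {x. x \<notin> ?N \<and> x < 0 \<and> x mod d = i mod d}" for i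
  proof -
    have "x \<in> ?N \<longleftrightarrow> x + d * charge d S i \<in> S" if "x mod d = i mod d" for x
      using charge_cong[OF that, of S] by (simp add: normalized_def)
    then have "{x \<in> ?N. 0 \<le> x \<and> x mod d = i mod d} = {x \<in> {x. x + d * charge d S i \<in> S}. 0 \<le> x \<and> x mod d = i mod d}"
      "{x. x \<notin> ?N \<and> x < 0 \<and> x mod d = i mod d} = {x. x \<notin> {x. x + d * charge d S i \<in> S} \<and> x < 0 \<and> x mod d = i mod d}"
      by auto
    then show "finite {x \<in> ?N. 0 \<le> x \<and> x mod d = i mod d}" "finite {x. x \<notin> ?N \<and> x < 0 \<and> x mod d = i mod d}"
      using finite_maya_nonneg[OF maya_set_shift_uniform[OF assms(1), of "d * charge d S i"], of "\<lambda>x. x mod d = i mod d"]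
        finite_maya_gaps[OF maya_set_shift_uniform[OF assms(1), of "d * charge d S i"], of "\<lambda>x. x mod d = i mod d"]
      by simp_all
  qed
  have "x \<in> ?N \<longleftrightarrow> x < 0" for x
  proof -
    let ?P = "{y \<in> ?N. 0 \<le> y \<and> y mod d = x mod d}"
    let ?G = "{y. y \<notin> ?N \<and> y < 0 \<and> y mod d = x mod d}"
    have c: "card ?P = card ?G" using charge_normalized[OF assms(1,2), of x] unfolding charge_def by simp
    have "?P = {} \<or> ?G = {}" using flushN by force
    then have "card ?P = 0" "card ?G = 0" using c by (elim disjE; simp only: card.empty)+
    then have "?P = {}" "?G = {}" by (simp_all only: card_0_eq[OF fin(1)] card_0_eq[OF fin(2)])
    then have "\<not> (x \<in> ?N \<and> 0 \<le> x)" "\<not> (x \<notin> ?N \<and> x < 0)" by blast+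
    then show ?thesis by linarith
  qed
  then show ?thesis by auto
qed

text \<open>The diagram form of the fact that core and quotient determine a partition: the charges
  carry the core, the normalized diagram carries the quotient.\<close>

lemma eq_if_normalized_eq:
  assumes "\<And>i. charge d S i = charge d T i" "normalized d S = normalized d T"
  shows "S = T"
proof -
  have "charge d S = charge d T" using assms(1) by (rule ext)
  then show ?thesis by (metis image_shift_normalized assms(2))
qed

section \<open>Hook lengths\<close>

text \<open>\<open>E\<close> is a union of residue classes, so the equality of the two counts in
  each class, which is what charge zero means, can be summed over the finitely many classes in
  \<open>E\<close>.\<close>

lemma card_periodic_charge_zero:
  assumes S: "maya_set S" and d: "0 < d" and z: "\<And>i. charge d S i = 0"
    and E: "\<And>u. u mod d \<in> E \<longleftrightarrow> u \<in> E"
  shows "card {u \<in> S. 0 \<le> u \<and> u \<in> E} = card {u. u \<notin> S \<and> u < 0 \<and> u \<in> E}"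
proof -
  let ?I = "{0..<d} \<inter> E"
  let ?P = "\<lambda>i. {u \<in> S. 0 \<le> u \<and> u mod d = i mod d}" 
  let ?G = "\<lambda>i. {u. u \<notin> S \<and> u < 0 \<and> u mod d = i mod d}"
  have P: "{u \<in> S. 0 \<le> u \<and> u \<in> E} = (\<Union>i\<in>?I. ?P i)"
    and G: "{u. u \<notin> S \<and> u < 0 \<and> u \<in> E} = (\<Union>i\<in>?I. ?G i)"
  proof -
    have "u \<in> E \<longleftrightarrow> (\<exists>i\<in>?I. u mod d = i mod d)" for u
    proof
      assume "u \<in> E"
      then show "\<exists>i\<in>?I. u mod d = i mod d" using d E[of u] by (intro bexI[of _ "u mod d"]) auto
    next
      assume "\<exists>i\<in>?I. u mod d = i mod d"
      then obtain i where "i \<in> E" "u mod d = i mod d" by blast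
      then show "u \<in> E" using E[of u] E[of i] by simp
    qed
    then show "{u \<in> S. 0 \<le> u \<and> u \<in> E} = (\<Union>i\<in>?I. ?P i)"
       "{u. u \<notin> S \<and> u < 0 \<and> u \<in> E} = (\<Union>i\<in>?I. ?G i)" by blast+
  qed
  have "card (\<Union>i\<in>?I. ?P i) = (\<Sum>i\<in>?I. card (?P i))"
    by (rule card_UN_disjoint) (use finite_maya_nonneg[OF S] in auto)
  moreover have "card (\<Union>i\<in>?I. ?G i) = (\<Sum>i\<in>?I. card (?G i))"
    by (rule card_UN_disjoint) (use finite_maya_gaps[OF S] in auto)
  moreover have "card (?P i) = card (?G i)" for i
    using z[of i] unfolding charge_def by simp
  ultimately show ?thesis unfolding P G by (simp only:)
qed

text \<open>Moves each residue class rigidly, by \<open>t\<close> steps of size \<open>d\<close>. It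
  is used with \<open>t\<close> the charge of the diagram of \<open>lam\<close>, and with a negated
  charge to describe \<open>normalized\<close>.\<close>

locale runner_shift =
  fixes d :: int and t :: "int \<Rightarrow> int"
  assumes d: "0 < d" and periodic: "x mod d = y mod d \<Longrightarrow> t x = t y"
begin

definition \<phi> where "\<phi> x = x + d * t x"
definition \<chi> where "\<chi> x = x - d * t x"

lemma t_shift [simp]: "t (x + d * k) = t x" "t (x - d * k) = t x"
  by (rule periodic; simp add: mod_diff_eq[symmetric, of _ "d * k"])+

text \<open>\<phi> does not leave a residue class and \<open>t\<close> is constant on it, so
  subtracting the same shift inverts \<phi>.\<close>

lemma \<phi>_\<chi> [simp]: "\<phi> (\<chi> x) = x" and \<chi>_\<phi> [simp]: "\<chi> (\<phi> x) = x"
  by (simp_all add: \<phi>_def \<chi>_def)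

lemma \<phi>_inj: "\<phi> x = \<phi> y \<longleftrightarrow> x = y"
  by (metis \<chi>_\<phi>)

lemma \<phi>_image: "x \<in> \<phi> ` S \<longleftrightarrow> \<chi> x \<in> S"
  by (metis \<phi>_\<chi> \<chi>_\<phi> imageE imageI)

lemma t_bounded: obtains T where "\<And>x. \<bar>t x\<bar> \<le> T"
proof
  fix x
  have "t x = t (x mod d)" by (rule periodic) simp
  then show "\<bar>t x\<bar> \<le> Max ((\<lambda>x. \<bar>t x\<bar>) ` {0..<d})"
    using d by (auto intro!: Max_ge)
qed

lemma maya_set_\<phi>_image:
  assumes "maya_set S" shows "maya_set (\<phi> ` S)"
proof -
  obtain N where N: "\<And>x. N \<le> x \<Longrightarrow> x \<notin> S" "\<And>x. x < -N \<Longrightarrow> x \<in> S"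
    using assms unfolding maya_set_def by auto
  obtain T where T: "\<And>x. \<bar>t x\<bar> \<le> T" using t_bounded by blast
  have b: "\<bar>x - \<chi> x\<bar> \<le> d * T" for x
    using T[of x] d by (simp add: \<chi>_def abs_mult)
  show ?thesis unfolding maya_set_def \<phi>_image
  proof (rule exI[of _ "N + d * T"], intro allI conjI impI)
    fix x
    show "\<chi> x \<notin> S" if "N + d * T \<le> x" using that b[of x] N(1)[of "\<chi> x"] by linarith
    show "\<chi> x \<in> S" if "x < - (N + d * T)" using that b[of x] N(2)[of "\<chi> x"] by linarith
  qed
qed

lemma \<phi>_\<chi>_add_mult: "\<phi> (x + d * k) = \<phi> x + d * k" "\<chi> (x + d * k) = \<chi> x + d * k"
  by (simp_all add: \<phi>_def \<chi>_def)

text \<open>Here \<open>\<psi> u\<close> is the partner of \<open>u\<close>: the \<open>v\<close> with \<open>\<phi> u - \<phi> v = n\<close>. The indicator of \<open>S\<close> differs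
  from that of the negative integers by a function whose sum over any union of residue classes is zero,
  so summing it over the \<open>u\<close> with \<open>u < \<psi> u\<close> gives the same result for \<open>S\<close> as for the negative integers.\<close>

lemma card_crossing:
  assumes S: "maya_set S" and z: "\<And>i. charge d S i = 0"
    and fin: "finite {u. u < 0 \<and> 0 \<le> \<chi> (\<phi> u - n)}"
  defines "\<psi> \<equiv> \<lambda>u. \<chi> (\<phi> u - n)"
  shows "card {u \<in> S. \<psi> u \<notin> S \<and> u < \<psi> u}
    = card {u. u \<notin> S \<and> \<psi> u \<in> S \<and> u < \<psi> u} + card {u. u < 0 \<and> 0 \<le> \<psi> u}"
proof -
  define E where "E = {u. u < \<psi> u}"
  define \<omega> where "\<omega> v = \<chi> (\<phi> v + n)" for v
  have \<psi>\<omega>: "\<psi> (\<omega> v) = v" "\<omega> (\<psi> v) = v" for v by (simp_all add: \<psi>_def \<omega>_def)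
  define F where "F = {v. \<omega> v < v}"
  have \<psi>_add: "\<psi> (u + d * k) = \<psi> u + d * k" for u k
  proof -
    have "\<phi> (u + d * k) - n = (\<phi> u - n) + d * k" by (simp add: \<phi>_\<chi>_add_mult)
    then show ?thesis unfolding \<psi>_def by (simp only: \<phi>_\<chi>_add_mult)
  qed
  have \<omega>_add: "\<omega> (u + d * k) = \<omega> u + d * k" for u k
  proof -
    have "\<phi> (u + d * k) + n = (\<phi> u + n) + d * k" by (simp add: \<phi>_\<chi>_add_mult)
    then show ?thesis unfolding \<omega>_def by (simp only: \<phi>_\<chi>_add_mult)
  qed
  have E: "u mod d \<in> E \<longleftrightarrow> u \<in> E" for u
  proof -
    have "\<psi> u = \<psi> (u mod d) + d * (u div d)"
      using \<psi>_add[of "u mod d" "u div d"] by simp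
    then show ?thesis using mod_mult_div_eq[of u d] unfolding E_def mem_Collect_eq by linarith
  qed
  have F: "u mod d \<in> F \<longleftrightarrow> u \<in> F" for u
  proof -
    have "\<omega> u = \<omega> (u mod d) + d * (u div d)"
      using \<omega>_add[of "u mod d" "u div d"] by simp
    then show ?thesis using mod_mult_div_eq[of u d] unfolding F_def mem_Collect_eq by linarith
  qed
  \<comment> \<open>\<open>X1\<close> and \<open>X2\<close> are the places where membership of
    \<open>u\<close> in \<open>S\<close> disagrees with \<open>u < 0\<close>; \<open>Y1\<close> and
    \<open>Y2\<close> are the same for \<open>\<psi> u\<close>. All are restricted to
    \<open>E\<close>.\<close>
  define X1 where "X1 = {u \<in> S. 0 \<le> u \<and> u \<in> E}"
  define X2 where "X2 = {u. u \<notin> S \<and> u < 0 \<and> u \<in> E}"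
  define Y1 where "Y1 = {u. \<psi> u \<in> S \<and> 0 \<le> \<psi> u \<and> u \<in> E}"
  define Y2 where "Y2 = {u. \<psi> u \<notin> S \<and> \<psi> u < 0 \<and> u \<in> E}"
  \<comment> \<open>Substituting \<open>v = \<psi> u\<close> turns the restriction to
    \<open>E\<close> into \<open>v \<in> F\<close>. This is again a union of residue classes, so
    \<open>card_periodic_charge_zero\<close> applies to \<open>Y1\<close> and \<open>Y2\<close> as
    well.\<close>
  have Y1: "Y1 = \<omega> ` {v \<in> S. 0 \<le> v \<and> v \<in> F}"
  proof (intro set_eqI iffI)
    fix u assume "u \<in> Y1"
    then have "\<psi> u \<in> {v \<in> S. 0 \<le> v \<and> v \<in> F}" by (auto simp: Y1_def E_def F_def \<psi>\<omega>)
    then show "u \<in> \<omega> ` {v \<in> S. 0 \<le> v \<and> v \<in> F}"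
      by (rule image_eqI[rotated]) (simp add: \<psi>\<omega>)
  qed (auto simp: Y1_def E_def F_def \<psi>\<omega>)
  have Y2: "Y2 = \<omega> ` {v. v \<notin> S \<and> v < 0 \<and> v \<in> F}"
  proof (intro set_eqI iffI)
    fix u assume "u \<in> Y2"
    then have "\<psi> u \<in> {v. v \<notin> S \<and> v < 0 \<and> v \<in> F}" by (auto simp: Y2_def E_def F_def \<psi>\<omega>)
    then show "u \<in> \<omega> ` {v. v \<notin> S \<and> v < 0 \<and> v \<in> F}"
      by (rule image_eqI[rotated]) (simp add: \<psi>\<omega>)
  qed (auto simp: Y2_def E_def F_def \<psi>\<omega>)
  have inj: "inj_on \<omega> A" for A by (metis \<psi>\<omega>(1) inj_onI)
  have XX: "card X1 = card X2"
    unfolding X1_def X2_def by (rule card_periodic_charge_zero[OF S d z E])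
  have YY: "card Y1 = card Y2"
    unfolding Y1 Y2 card_image[OF inj] by (rule card_periodic_charge_zero[OF S d z F])
  define A where "A = {u \<in> S. \<psi> u \<notin> S \<and> u < \<psi> u}"
  define B where "B = {u. u \<notin> S \<and> \<psi> u \<in> S \<and> u < \<psi> u}"
  define C where "C = {u. u < 0 \<and> 0 \<le> \<psi> u}"
  \<comment> \<open>\<open>A\<close> and \<open>B\<close> lie in \<open>G\<close> too: a pair with
    exactly one end in \<open>S\<close> either crosses 0 or has an end that disagrees with the
    negative integers.\<close>
  define G where "G = C \<union> X1 \<union> X2 \<union> Y1 \<union> Y2"
  have "finite X1" "finite X2" "finite Y1" "finite Y2"
    unfolding X1_def X2_def Y1 Y2 using finite_maya_nonneg[OF S] finite_maya_gaps[OF S] by auto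
  then have G: "finite G" using fin by (simp add: G_def C_def \<psi>_def)
  have c: "int (card Z) = (\<Sum>u\<in>G. of_bool (u \<in> Z))" if "Z \<subseteq> G" for Z
    using that G by (simp add: Int_absorb1 Int_def[symmetric] sum.If_cases of_bool_def)
  have sub: "A \<subseteq> G" "B \<subseteq> G" "C \<subseteq> G" "X1 \<subseteq> G" "X2 \<subseteq> G" "Y1 \<subseteq> G" "Y2 \<subseteq> G"
    by (auto simp: A_def B_def C_def X1_def X2_def Y1_def Y2_def E_def G_def)
  \<comment> \<open>For \<open>u < \<psi> u\<close>, \<open>A\<close> minus \<open>B\<close> is the
    difference of the indicator of \<open>S\<close> at \<open>u\<close> and at
    \<open>\<psi> u\<close>, and \<open>C\<close> is that difference for the negative integers. The
    other four sets make up the discrepancy.\<close>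
  have "of_bool (u \<in> A) + of_bool (u \<in> X2) + of_bool (u \<in> Y1) =
    (of_bool (u \<in> B) + of_bool (u \<in> C) + of_bool (u \<in> X1) + of_bool (u \<in> Y2) :: int)" for u
    by (auto simp: A_def B_def C_def X1_def X2_def Y1_def Y2_def E_def of_bool_def)
  then have "(\<Sum>u\<in>G. of_bool (u \<in> A) + of_bool (u \<in> X2) + of_bool (u \<in> Y1)) =
    (\<Sum>u\<in>G. of_bool (u \<in> B) + of_bool (u \<in> C) + of_bool (u \<in> X1) + of_bool (u \<in> Y2) :: int)" by simp
  then have "int (card A) + int (card X2) + int (card Y1) = int (card B) + int (card C) + int (card X1) + int (card Y2)"
    unfolding c[OF sub(1)] c[OF sub(2)] c[OF sub(3)] c[OF sub(4)] c[OF sub(5)] c[OF sub(6)] c[OF sub(7)]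
    by (simp only: sum.distrib)
  then show ?thesis using XX YY unfolding A_def[symmetric] B_def[symmetric] C_def[symmetric] by linarith
qed

text \<open>A hook of known length is determined by its bead; the parameter \<open>u\<close> is the
  preimage of that bead under \<phi>.\<close>

lemma bij_hook_pairs_length:
  assumes "0 < n"
  shows "bij_betw (\<lambda>u. (\<phi> u, \<phi> u - n)) {u \<in> S. \<chi> (\<phi> u - n) \<notin> S}
    {(x, y) \<in> hook_pairs (\<phi> ` S). x - y = n}"
  unfolding bij_betw_def
proof
  show "inj_on (\<lambda>u. (\<phi> u, \<phi> u - n)) {u \<in> S. \<chi> (\<phi> u - n) \<notin> S}"
    by (auto simp: inj_on_def \<phi>_inj)
  show "(\<lambda>u. (\<phi> u, \<phi> u - n)) ` {u \<in> S. \<chi> (\<phi> u - n) \<notin> S} = {(x, y) \<in> hook_pairs (\<phi> ` S). x - y = n}"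
  proof (intro set_eqI iffI)
    fix z assume z: "z \<in> {(x, y) \<in> hook_pairs (\<phi> ` S). x - y = n}"
    obtain x y where xy: "z = (x, y)" by (cases z)
    have "\<chi> x \<in> S" "\<chi> y \<notin> S" "y = x - n"
      using z unfolding xy hook_pairs_def \<phi>_image by simp_all
    then show "z \<in> (\<lambda>u. (\<phi> u, \<phi> u - n)) ` {u \<in> S. \<chi> (\<phi> u - n) \<notin> S}"
      unfolding xy by (intro image_eqI[of _ _ "\<chi> x"]) simp_all
  next
    fix z assume "z \<in> (\<lambda>u. (\<phi> u, \<phi> u - n)) ` {u \<in> S. \<chi> (\<phi> u - n) \<notin> S}"
    then obtain u where u: "z = (\<phi> u, \<phi> u - n)" "u \<in> S" "\<chi> (\<phi> u - n) \<notin> S" by blast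
    then show "z \<in> {(x, y) \<in> hook_pairs (\<phi> ` S). x - y = n}"
      unfolding u(1) hook_pairs_def mem_Collect_eq case_prod_conv \<phi>_image using assms by simp
  qed
qed

text \<open>For length \<open>n\<close>, hooks of the image are the \<open>u\<close> in
  \<open>S\<close> whose partner \<open>\<psi> u\<close> is not in \<open>S\<close>. If
  \<open>\<psi> u < u\<close>, this is a hook of \<open>S\<close>. The others are counted by
  \<open>card_crossing\<close>: they match the hooks \<open>(\<psi> u, u)\<close> of
  \<open>S\<close> that \<phi> turns around, together with the hooks in the image of the negative
  integers.\<close>

lemma hook_pairs_\<phi>:
  assumes S: "maya_set S" and z: "\<And>i. charge d S i = 0"
  shows "pair_lengths id (hook_pairs (\<phi> ` S)) =
    pair_lengths id (hook_pairs (\<phi> ` {..<0})) + pair_lengths \<phi> (hook_pairs S)"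
proof (rule multiset_eqI)
  fix k :: nat
  note fin = finite_hook_pairs[OF maya_set_\<phi>_image[OF S]] finite_hook_pairs[OF maya_set_\<phi>_image[OF maya_set_lessThan]]
    finite_hook_pairs[OF S]
  have cnt: "count (pair_lengths f W) k = card {(x, y) \<in> W. nat \<bar>f x - f y\<bar> = k}" if "finite W" for f W
    unfolding pair_lengths_def count_image_mset_set[OF that]
    by (rule arg_cong[of _ _ card]) auto
  show "count (pair_lengths id (hook_pairs (\<phi> ` S))) k =
    count (pair_lengths id (hook_pairs (\<phi> ` {..<0})) + pair_lengths \<phi> (hook_pairs S)) k"
  proof (cases "k = 0")
    case True
    have "{(x, y) \<in> hook_pairs U. nat \<bar>id x - id y\<bar> = k} = {}" for U
      using True by (auto simp: hook_pairs_def)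
    moreover have "{(x, y) \<in> hook_pairs S. nat \<bar>\<phi> x - \<phi> y\<bar> = k} = {}"
      using True by (auto simp: hook_pairs_def \<phi>_inj)
    ultimately show ?thesis using fin by (simp only: cnt count_union card.empty add_0)
  next
    case False
    define n where "n = int k"
    have n: "0 < n" using False by (simp add: n_def)
    define \<psi> where "\<psi> u = \<chi> (\<phi> u - n)" for u
    have \<phi>\<psi>: "\<phi> (\<psi> u) = \<phi> u - n" for u by (simp add: \<psi>_def)
    have \<psi>I: "v = \<psi> u" if "\<phi> u - \<phi> v = n" for u v using that by (metis \<phi>\<psi> \<phi>_inj add_diff_cancel_left' diff_add_cancel)
    have ne: "\<psi> u \<noteq> u" for u using \<phi>\<psi>[of u] n by auto
    have H: "{(x, y) \<in> hook_pairs U. nat \<bar>id x - id y\<bar> = k} = {(x, y) \<in> hook_pairs U. x - y = n}" for U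
      by (auto simp: hook_pairs_def n_def)
    have cH: "card {(x, y) \<in> hook_pairs (\<phi> ` U). nat \<bar>id x - id y\<bar> = k} = card {u \<in> U. \<psi> u \<notin> U}" for U
      unfolding H \<psi>_def using bij_betw_same_card[OF bij_hook_pairs_length[OF n]] by simp
    have fU: "finite {u \<in> U. \<psi> u \<notin> U}" if "maya_set U" for U
      using finite_subset[OF _ finite_hook_pairs[OF maya_set_\<phi>_image[OF that]], of "{(x, y) \<in> hook_pairs (\<phi> ` U). x - y = n}"]
        bij_betw_finite[OF bij_hook_pairs_length[OF n, of U]] unfolding \<psi>_def by blast
    have neg: "{u \<in> {..<0}. \<psi> u \<notin> {..<0}} = {u. u < 0 \<and> 0 \<le> \<psi> u}" by auto
    have fneg: "finite {u. u < 0 \<and> 0 \<le> \<psi> u}" using fU[of "{..<0}"] unfolding neg by simp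
    define A where "A = {u \<in> S. \<psi> u \<notin> S \<and> u < \<psi> u}"
    define A' where "A' = {u \<in> S. \<psi> u \<notin> S \<and> \<psi> u < u}"
    define B where "B = {u. u \<notin> S \<and> \<psi> u \<in> S \<and> u < \<psi> u}"
    have AA: "{u \<in> S. \<psi> u \<notin> S} = A \<union> A'" unfolding A_def A'_def using ne
      by (auto simp: not_less order.order_iff_strict)
    have fAA: "finite A" "finite A'" using fU[OF S] unfolding AA by auto
    have cAA: "card {u \<in> S. \<psi> u \<notin> S} = card A + card A'"
      unfolding AA by (rule card_Un_disjoint[OF fAA]) (auto simp: A_def A'_def)
    have main: "card A = card B + card {u. u < 0 \<and> 0 \<le> \<psi> u}"
      unfolding A_def B_def \<psi>_def by (rule card_crossing[OF S z]) (use fneg in \<open>simp add: \<psi>_def\<close>)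
    have split: "{(x, y) \<in> hook_pairs S. nat \<bar>\<phi> x - \<phi> y\<bar> = k} = (\<lambda>u. (u, \<psi> u)) ` A' \<union> (\<lambda>u. (\<psi> u, u)) ` B"
      (is "?L = ?R")
    proof (intro set_eqI iffI)
      fix p assume "p \<in> ?L"
      then obtain x y where p: "p = (x, y)" "x \<in> S" "y \<notin> S" "y < x" "nat \<bar>\<phi> x - \<phi> y\<bar> = k"
        by (auto simp: hook_pairs_def)
      from p(5) have "\<phi> x - \<phi> y = n \<or> \<phi> y - \<phi> x = n" using n by (auto simp: n_def)
      then show "p \<in> ?R"
      proof
        assume "\<phi> x - \<phi> y = n"
        then have "y = \<psi> x" by (rule \<psi>I)
        then show ?thesis using p by (auto simp: A'_def)
      next
        assume "\<phi> y - \<phi> x = n"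
        then have "x = \<psi> y" by (rule \<psi>I)
        then show ?thesis using p by (auto simp: B_def)
      qed
    qed (auto simp: A'_def B_def hook_pairs_def \<phi>\<psi> n_def)
    have "card ?L = card ((\<lambda>u. (u, \<psi> u)) ` A') + card ((\<lambda>u. (\<psi> u, u)) ` B)"
    proof -
      \<comment> \<open>A common pair would satisfy \<open>\<psi> (\<psi> v) = v\<close>, but two
        steps of \<psi> lower \<phi> by \<open>2 * n\<close>.\<close>
      have disj: "(\<lambda>u. (u, \<psi> u)) ` A' \<inter> (\<lambda>u. (\<psi> u, u)) ` B = {}"
      proof -
        have False if "u = \<psi> v" "\<psi> u = v" for u v
          using \<phi>\<psi>[of u] \<phi>\<psi>[of v] that n by simp
        then show ?thesis by auto
      qed
      have f: "finite ((\<lambda>u. (u, \<psi> u)) ` A' \<union> (\<lambda>u. (\<psi> u, u)) ` B)"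
        unfolding split[symmetric] using fin(3) by (rule rev_finite_subset) auto
      then show ?thesis unfolding split using card_Un_disjoint[OF _ _ disj] by auto
    qed
    moreover have "card ((\<lambda>u. (u, \<psi> u)) ` A') = card A'" "card ((\<lambda>u. (\<psi> u, u)) ` B) = card B"
      by (rule card_image; auto simp: inj_on_def)+
    ultimately have "card {(x, y) \<in> hook_pairs S. nat \<bar>\<phi> x - \<phi> y\<bar> = k} = card A' + card B" by simp
    then show ?thesis
      unfolding count_union cnt[OF fin(1)] cnt[OF fin(2)] cnt[OF fin(3)] cH neg cAA main by simp
  qed
qed

end

section \<open>Bars as half of the hooks\<close>

text \<open>Since \<phi> is odd, \<open>(x, y) \<mapsto> (- y, - x)\<close> preserves lengths. It
  exchanges the bars with \<open>y \<noteq> 0\<close> and the hooks with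
  \<open>\<bar>x\<bar> < - y\<close>. Left over are the bars \<open>(x, 0)\<close>, which give the
  parts, and the fixed hooks \<open>(x, - x)\<close>, which give the doubled parts.\<close>

lemma pair_lengths_fold:
  assumes S: "maya_set S" "bar_symmetric S" and odd: "\<And>x. \<phi> (- x) = - \<phi> x"
  shows "pair_lengths \<phi> (hook_pairs S) + {# nat \<bar>\<phi> x\<bar>. x \<in># mset_set {x \<in> S. 0 < x} #} =
    pair_lengths \<phi> (bar_pairs S) + pair_lengths \<phi> (bar_pairs S)
      + {# 2 * nat \<bar>\<phi> x\<bar>. x \<in># mset_set {x \<in> S. 0 < x} #}"
proof -
  have \<phi>0: "\<phi> 0 = 0" using odd[of 0] by simp
  have sym: "0 \<notin> S" "\<And>x. x \<noteq> 0 \<Longrightarrow> x \<in> S \<longleftrightarrow> - x \<notin> S"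
    using S(2) unfolding bar_symmetric_def by blast+
  let ?P = "{x \<in> S. 0 < x}"
  define W where "W = bar_pairs S"
  \<comment> \<open>The bars \<open>(x, 0)\<close> have no mirror image, as 0 is not a bead.\<close>
  define W0 where "W0 = (\<lambda>x. (x, 0::int)) ` ?P"
  define W1 where "W1 = W - W0"
  define V where "V = (\<lambda>(x, y). (- y, - x)) ` W1"
  define D where "D = (\<lambda>x. (x, - x)) ` ?P"
  have W1: "(x, y) \<in> W1 \<longleftrightarrow> x \<in> S \<and> y \<notin> S \<and> \<bar>y\<bar> < x \<and> y \<noteq> 0" for x y
    by (auto simp: W1_def W0_def W_def bar_pairs_def)
  have H: "hook_pairs S = W \<union> V \<union> D"
  proof (intro set_eqI iffI)
    fix p assume "p \<in> hook_pairs S"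
    then obtain x y where p: "p = (x, y)" "x \<in> S" "y \<notin> S" "y < x" by (auto simp: hook_pairs_def)
    consider "\<bar>y\<bar> < x" | "x = - y" | "\<bar>x\<bar> < - y" using p by linarith
    then show "p \<in> W \<union> V \<union> D"
    proof cases
      case 3
      have x0: "x \<noteq> 0" using p sym(1) by auto
      then have "(- y, - x) \<in> W1" using 3 p sym(2)[of y] sym(2)[of x]
        unfolding W1 by auto
      then have "(\<lambda>(x, y). (- y, - x)) (- y, - x) \<in> V" unfolding V_def by (rule imageI)
      then show ?thesis using p by simp
    qed (use p in \<open>auto simp: W_def bar_pairs_def D_def\<close>)
  next
    fix p assume "p \<in> W \<union> V \<union> D"
    then consider "p \<in> W" | "p \<in> V" | "p \<in> D" by blast
    then show "p \<in> hook_pairs S"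
    proof cases
      case 2
      then obtain x y where p: "p = (- y, - x)" "x \<in> S" "y \<notin> S" "\<bar>y\<bar> < x" "y \<noteq> 0"
        unfolding V_def by (auto simp: W1)
      then show ?thesis using sym(2)[of x] sym(2)[of y] by (auto simp: hook_pairs_def)
    next
      case 3
      then obtain x where "p = (x, - x)" "x \<in> S" "0 < x" by (auto simp: D_def)
      then show ?thesis using sym(2)[of x] by (auto simp: hook_pairs_def)
    qed (auto simp: W_def bar_pairs_def hook_pairs_def)
  qed
  have fin: "finite W" "finite V" "finite D"
    using finite_hook_pairs[OF S(1)] unfolding H by auto
  have W0: "W0 \<subseteq> W" using sym(1) by (auto simp: W0_def W_def bar_pairs_def)
  have WW: "W = W0 \<union> W1" "W0 \<inter> W1 = {}" using W0 by (auto simp: W1_def)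
  have fin': "finite W0" "finite W1" using fin WW by auto
  have W0s: "pair_lengths \<phi> W0 = {# nat \<bar>\<phi> x\<bar>. x \<in># mset_set ?P #}"
    unfolding pair_lengths_def W0_def
    by (subst image_mset_mset_set[symmetric]) (auto simp: inj_on_def multiset.map_comp comp_def \<phi>0)
  have Ds: "pair_lengths \<phi> D = {# 2 * nat \<bar>\<phi> x\<bar>. x \<in># mset_set ?P #}"
  proof -
    have "nat \<bar>2 * \<phi> x\<bar> = 2 * nat \<bar>\<phi> x\<bar>" for x by (simp add: abs_mult nat_mult_distrib)
    then show ?thesis
    unfolding pair_lengths_def D_def
    by (subst image_mset_mset_set[symmetric]) (auto simp: inj_on_def multiset.map_comp comp_def odd simp flip: mult_2)
  qed
  have Vs: "pair_lengths \<phi> V = pair_lengths \<phi> W1"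
    unfolding pair_lengths_def V_def
    by (subst image_mset_mset_set[symmetric]) (auto simp: inj_on_def multiset.map_comp comp_def odd case_prod_unfold)
  have Ws: "pair_lengths \<phi> W = pair_lengths \<phi> W0 + pair_lengths \<phi> W1"
    unfolding pair_lengths_def by (subst WW(1), subst mset_set_Union[OF fin' WW(2)]) simp
  have d1: "W \<inter> V = {}" "(W \<union> V) \<inter> D = {}"
    by (auto simp: V_def W1_def W_def D_def bar_pairs_def)
  have Hs: "pair_lengths \<phi> (hook_pairs S) = pair_lengths \<phi> W + pair_lengths \<phi> V + pair_lengths \<phi> D"
    unfolding pair_lengths_def H using fin d1 by (simp add: mset_set_Union)
  show ?thesis unfolding Hs Ds Vs W_def[symmetric] Ws W0s by (simp add: ac_simps)
qed

section \<open>The Maya diagram of a partition\<close>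

definition is_partition :: "nat list \<Rightarrow> bool" where
  "is_partition \<nu> \<longleftrightarrow> sorted_wrt (\<ge>) \<nu> \<and> 0 \<notin> set \<nu>"

definition bead :: "nat list \<Rightarrow> nat \<Rightarrow> int" where
  "bead \<nu> r = int (row_len \<nu> r) - int r"

text \<open>The position of the horizontal boundary step under column \<open>c\<close>. The summand
  -1 makes bead minus gap equal to the hook length.\<close>

definition gap :: "nat list \<Rightarrow> nat \<Rightarrow> int" where
  "gap \<nu> c = int c - 1 - int (col_len \<nu> c)"

text \<open>All \<open>r \<ge> 1\<close> take part: rows past the last have length 0 and supply the
  infinitely many beads \<open>- r\<close>.\<close>

definition maya :: "nat list \<Rightarrow> int set" where
  "maya \<nu> = bead \<nu> ` {1..}"

section \<open>Rows, columns and the boundary path of a partition\<close>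

lemma row_len_antimono:
  assumes "sorted_wrt (\<ge>) \<nu>" "1 \<le> r" "r \<le> s"
  shows "row_len \<nu> s \<le> row_len \<nu> r"
  using assms sorted_wrt_nth_less[OF assms(1), of "r - 1" "s - 1"]
  by (cases "r = s") (auto simp: row_len_def)

lemma row_len_beyond: "length \<nu> < r \<Longrightarrow> row_len \<nu> r = 0"
  by (simp add: row_len_def)

lemma row_len_pos_iff:
  assumes "is_partition \<nu>" shows "0 < row_len \<nu> r \<longleftrightarrow> 1 \<le> r \<and> r \<le> length \<nu>"
proof -
  have "\<nu> ! (r - 1) \<in> set \<nu>" if "1 \<le> r" "r \<le> length \<nu>" using that by simp
  then have "\<nu> ! (r - 1) \<noteq> 0" if "1 \<le> r" "r \<le> length \<nu>"
    using that assms unfolding is_partition_def by metis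
  then show ?thesis by (auto simp: row_len_def)
qed

lemma sorted_from_row_len:
  assumes "\<And>r. 1 \<le> r \<Longrightarrow> Suc r \<le> length \<nu> \<Longrightarrow> row_len \<nu> (Suc r) \<le> row_len \<nu> r"
  shows "sorted_wrt (\<ge>) \<nu>"
proof -
  have "\<nu> ! Suc i \<le> \<nu> ! i" if "Suc i < length \<nu>" for i
    using assms[of "Suc i"] that by (simp add: row_len_def)
  then show ?thesis by (simp add: sorted_wrt_iff_nth_Suc_transp transp_on_ge)
qed

lemma row_len_Cons: "row_len (x # xs) r = (if r = 1 then x else row_len xs (r - 1))"
  by (cases r) (auto simp: row_len_def nth_Cons')

lemma row_len_filter_pos:
  assumes "sorted_wrt (\<ge>) \<nu>"
  shows "row_len (filter (\<lambda>x. 0 < x) \<nu>) r = row_len \<nu> r"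
  using assms
proof (induction \<nu> arbitrary: r)
  case (Cons x \<nu>)
  show ?case
  proof (cases "x = 0")
    case True
    then have z: "\<forall>y\<in>set \<nu>. y = 0" using Cons.prems by simp
    then have "filter (\<lambda>x. 0 < x) (x # \<nu>) = []" using True by (simp add: filter_empty_conv)
    moreover have "row_len (x # \<nu>) r = 0"
      using z True nth_mem[of "r - 1" "x # \<nu>"] unfolding row_len_def by fastforce
    ultimately show ?thesis by (simp add: row_len_def)
  qed (use Cons in \<open>simp add: row_len_Cons\<close>)
qed simp

lemma is_partition_filter_pos: "sorted_wrt (\<ge>) \<nu> \<Longrightarrow> is_partition (filter (\<lambda>x. 0 < x) \<nu>)"
  by (simp add: is_partition_def sorted_wrt_filter)

lemma partition_eqI:
  assumes "is_partition \<nu>" "is_partition \<nu>'" "\<And>r. 1 \<le> r \<Longrightarrow> row_len \<nu> r = row_len \<nu>' r"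
  shows "\<nu> = \<nu>'"
proof -
  have "1 \<le> r \<and> r \<le> length \<nu> \<longleftrightarrow> 1 \<le> r \<and> r \<le> length \<nu>'" for r
    using row_len_pos_iff[OF assms(1), of r] row_len_pos_iff[OF assms(2), of r] assms(3)[of r] by auto
  from this[of "length \<nu>"] this[of "length \<nu>'"] have len: "length \<nu> = length \<nu>'"
    by (cases "length \<nu>"; cases "length \<nu>'") auto
  moreover have "\<nu> ! i = \<nu>' ! i" if "i < length \<nu>" for i
    using assms(3)[of "Suc i"] that len by (simp add: row_len_def)
  ultimately show ?thesis by (rule nth_equalityI)
qed

text \<open>The rows reaching column \<open>c\<close> form an initial segment, and
  \<open>col_len\<close> counts them.\<close>

lemma le_row_len_iff:
  assumes "sorted_wrt (\<ge>) \<nu>" "1 \<le> r" "1 \<le> c"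
  shows "c \<le> row_len \<nu> r \<longleftrightarrow> r \<le> col_len \<nu> c"
proof -
  let ?A = "{r. 1 \<le> r \<and> r \<le> length \<nu> \<and> c \<le> row_len \<nu> r}"
  have fin: "finite ?A" by (rule finite_subset[of _ "{..length \<nu>}"]) auto
  show ?thesis
  proof
    assume a: "c \<le> row_len \<nu> r"
    have "{1..r} \<subseteq> ?A"
    proof
      fix s assume s: "s \<in> {1..r}"
      then have "c \<le> row_len \<nu> s" using row_len_antimono[OF assms(1), of s r] a by auto
      then show "s \<in> ?A" using s row_len_beyond[of \<nu> s] assms(3) by force
    qed
    then have "card {1..r} \<le> card ?A" by (rule card_mono[OF fin])
    then show "r \<le> col_len \<nu> c" by (simp add: col_len_def)
  next
    assume a: "r \<le> col_len \<nu> c"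
    show "c \<le> row_len \<nu> r"
    proof (rule ccontr)
      assume n: "\<not> c \<le> row_len \<nu> r"
      have "?A \<subseteq> {1..<r}"
      proof
        fix s assume s: "s \<in> ?A"
        then have "\<not> r \<le> s" using row_len_antimono[OF assms(1,2), of s] n by auto
        then show "s \<in> {1..<r}" using s by simp
      qed
      then have "card ?A \<le> card {1..<r}" by (intro card_mono) auto
      then show False using a assms(2) by (simp add: col_len_def)
    qed
  qed
qed

lemma young_diagram_iff:
  "(r, c) \<in> young_diagram \<nu> \<longleftrightarrow> 1 \<le> r \<and> 1 \<le> c \<and> c \<le> row_len \<nu> r"
  using row_len_beyond[of \<nu> r] by (force simp: young_diagram_def)

lemma bead_decreasing:
  assumes "sorted_wrt (\<ge>) \<nu>" "1 \<le> r" "r < s"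
  shows "bead \<nu> s < bead \<nu> r"
  using row_len_antimono[OF assms(1,2), of s] assms(3) by (simp add: bead_def)

lemma bead_eq_iff:
  assumes "sorted_wrt (\<ge>) \<nu>" "1 \<le> r" "1 \<le> s"
  shows "bead \<nu> r = bead \<nu> s \<longleftrightarrow> r = s"
  using bead_decreasing[OF assms(1)] assms(2,3) by (metis less_irrefl linorder_neqE_nat)

text \<open>Bead minus gap is at least 1 at nodes of the diagram and at most -1 elsewhere, because
  by \<open>le_row_len_iff\<close> the node lies beyond its row exactly when it lies beyond its
  column.\<close>

lemma gap_less_bead_iff:
  assumes "sorted_wrt (\<ge>) \<nu>" "1 \<le> r" "1 \<le> c"
  shows "gap \<nu> c < bead \<nu> r \<longleftrightarrow> (r, c) \<in> young_diagram \<nu>" and "gap \<nu> c \<noteq> bead \<nu> r"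
proof -
  have "(c \<le> row_len \<nu> r \<and> r \<le> col_len \<nu> c) \<or> (row_len \<nu> r < c \<and> col_len \<nu> c < r)"
    using le_row_len_iff[OF assms] by linarith
  then show "gap \<nu> c < bead \<nu> r \<longleftrightarrow> (r, c) \<in> young_diagram \<nu>" "gap \<nu> c \<noteq> bead \<nu> r"
    using assms unfolding young_diagram_iff gap_def bead_def by auto
qed

lemma gap_increasing:
  assumes "sorted_wrt (\<ge>) \<nu>" "1 \<le> c" "c < e"
  shows "gap \<nu> c < gap \<nu> e"
proof -
  have "col_len \<nu> e \<le> col_len \<nu> c"
    unfolding col_len_def
    by (rule card_mono) (use assms in \<open>auto intro: finite_subset[of _ "{..length \<nu>}"]\<close>)
  then show ?thesis using assms by (simp add: gap_def)
qed

lemma gap_eq_iff: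
  assumes "sorted_wrt (\<ge>) \<nu>" "1 \<le> r" "1 \<le> s"
  shows "gap \<nu> r = gap \<nu> s \<longleftrightarrow> r = s"
  using gap_increasing[OF assms(1)] assms(2,3) by (metis less_irrefl linorder_neqE_nat)

text \<open>The boundary path of the partition passes each integer once, by a vertical step (bead)
  or a horizontal one (gap).\<close>

lemma Compl_maya:
  assumes "sorted_wrt (\<ge>) \<nu>"
  shows "- maya \<nu> = gap \<nu> ` {1..}"
proof (intro set_eqI iffI)
  fix z assume z: "z \<in> - maya \<nu>"
  have "bead \<nu> (nat (\<bar>z\<bar>) + length \<nu> + 1) < z"
    using row_len_beyond[of \<nu> "nat (\<bar>z\<bar>) + length \<nu> + 1"] by (simp add: bead_def)
  \<comment> \<open>\<open>s\<close> is the first row whose bead lies below \<open>z\<close>; it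
    exists as the beads tend to minus infinity.\<close>
  define s where "s = (LEAST s. 1 \<le> s \<and> bead \<nu> s < z)"
  have s: "1 \<le> s \<and> bead \<nu> s < z"
    unfolding s_def by (rule LeastI[of _ "nat (\<bar>z\<bar>) + length \<nu> + 1"]) (use \<open>bead _ _ < z\<close> in simp)
  have least: "z < bead \<nu> r" if "1 \<le> r" "r < s" for r
  proof -
    have "\<not> bead \<nu> r < z" using not_less_Least[of r "\<lambda>s. 1 \<le> s \<and> bead \<nu> s < z"] that by (auto simp: s_def)
    moreover have "bead \<nu> r \<noteq> z" using z that by (auto simp: maya_def)
    ultimately show ?thesis by linarith
  qed
  \<comment> \<open>A column of length \<open>s - 1\<close> has its gap at
    \<open>c - 1 - (s - 1)\<close>; equating this with \<open>z\<close> gives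
    \<open>c\<close>.\<close>
  define c where "c = nat (z + int s)"
  have "- int s < z" using s by (simp add: bead_def)
  then have c: "1 \<le> c" "int c = z + int s" by (auto simp: c_def)
  have "\<not> c \<le> row_len \<nu> s" using s c by (simp add: bead_def)
  then have "col_len \<nu> c < s" using le_row_len_iff[OF assms, of s c] s c by simp
  moreover have "s - 1 \<le> col_len \<nu> c"
  proof (cases "s = 1")
    case False
    then have s1: "1 \<le> s - 1" using s by linarith
    then have "z < bead \<nu> (s - 1)" using least[of "s - 1"] by simp
    then have "c \<le> row_len \<nu> (s - 1)" using c s by (simp add: bead_def)
    then show ?thesis using le_row_len_iff[OF assms s1 c(1)] by simp
  qed simp
  ultimately have "gap \<nu> c = z" using c s by (simp add: gap_def)
  then show "z \<in> gap \<nu> ` {1..}" using c by auto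
next
  fix z assume "z \<in> gap \<nu> ` {1..}"
  then show "z \<in> - maya \<nu>" using gap_less_bead_iff(2)[OF assms] by (force simp: maya_def)
qed

lemma below_length_in_maya:
  assumes "x < - int (length \<nu>)" shows "x \<in> maya \<nu>"
proof -
  have "x = bead \<nu> (nat (- x))" "1 \<le> nat (- x)"
    using assms row_len_beyond[of \<nu> "nat (- x)"] by (auto simp: bead_def)
  then show ?thesis unfolding maya_def by (metis atLeast_iff imageI)
qed

lemma maya_set_maya:
  assumes "sorted_wrt (\<ge>) \<nu>" shows "maya_set (maya \<nu>)"
  unfolding maya_set_def
proof (rule exI[of _ "int (row_len \<nu> 1 + length \<nu>)"], intro allI conjI impI)
  fix x :: int
  show "x \<notin> maya \<nu>" if "int (row_len \<nu> 1 + length \<nu>) \<le> x"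
  proof
    assume "x \<in> maya \<nu>"
    then obtain r where "1 \<le> r" "x = bead \<nu> r" by (auto simp: maya_def)
    then show False using row_len_antimono[OF assms, of 1 r] that by (simp add: bead_def)
  qed
  show "x \<in> maya \<nu>" if "x < - int (row_len \<nu> 1 + length \<nu>)"
    using that by (intro below_length_in_maya) simp
qed

text \<open>Beads decrease strictly, so the one of row \<open>s\<close> is the \<open>s\<close>-th
  largest element of the diagram.\<close>

lemma bead_eq_if_maya_eq:
  assumes "sorted_wrt (\<ge>) \<nu>" "sorted_wrt (\<ge>) \<nu>'" "maya \<nu> = maya \<nu>'" "1 \<le> s"
  shows "bead \<nu> s = bead \<nu>' s"
  using assms(4)
proof (induction s rule: less_induct)
  case (less s)
  have le: "bead \<nu>1 s \<le> bead \<nu>2 s"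
    if "sorted_wrt (\<ge>) \<nu>1" "sorted_wrt (\<ge>) \<nu>2" "maya \<nu>1 = maya \<nu>2" and
      IH: "\<And>r. r < s \<Longrightarrow> 1 \<le> r \<Longrightarrow> bead \<nu>1 r = bead \<nu>2 r" for \<nu>1 \<nu>2
  proof -
    have "bead \<nu>1 s \<in> maya \<nu>2" using that(3) less.prems by (auto simp: maya_def)
    then obtain r where r: "1 \<le> r" "bead \<nu>1 s = bead \<nu>2 r" by (auto simp: maya_def)
    have "\<not> r < s" using IH[of r] r bead_decreasing[OF that(1), of r s] by auto
    then show ?thesis using bead_decreasing[OF that(2) less.prems, of r] r by (cases "r = s") auto
  qed
  show ?case
    using le[OF assms(1,2,3)] le[OF assms(2,1) assms(3)[symmetric]] less.IH by force
qed

lemma maya_inject: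
  assumes "is_partition \<nu>" "is_partition \<nu>'" "maya \<nu> = maya \<nu>'"
  shows "\<nu> = \<nu>'"
proof (rule partition_eqI[OF assms(1,2)])
  fix r :: nat assume "1 \<le> r"
  then have "bead \<nu> r = bead \<nu>' r"
    using bead_eq_if_maya_eq[OF _ _ assms(3)] assms(1,2) by (auto simp: is_partition_def)
  then show "row_len \<nu> r = row_len \<nu>' r" by (simp add: bead_def)
qed

lemma maya_Nil: "maya [] = {..<0}"
proof (intro set_eqI iffI)
  fix x :: int assume "x \<in> {..<0}"
  then show "x \<in> maya []" using below_length_in_maya[of x "[]"] by simp
qed (auto simp: maya_def bead_def row_len_def)

section \<open>Removal of hooks and cores\<close>

lemma int_hook_length:
  assumes "sorted_wrt (\<ge>) \<nu>" "(r, c) \<in> young_diagram \<nu>"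
  shows "int (hook_length \<nu> (r, c)) = bead \<nu> r - gap \<nu> c"
  using assms le_row_len_iff[OF assms(1), of r c]
  by (simp add: young_diagram_iff hook_length_def bead_def gap_def)

text \<open>With \<open>f\<close> the foot row, rows \<open>r\<close> to \<open>f - 1\<close> take
  over the beads of rows \<open>r + 1\<close> to \<open>f\<close>, and row \<open>f\<close> gets a
  bead at the gap of column \<open>c\<close>. As a set, the diagram changes by the move of one bead.
  The third claim provides the measure for termination.\<close>

lemma remove_hook:
  assumes \<nu>: "is_partition \<nu>" and z: "(r, c) \<in> young_diagram \<nu>"
  shows "is_partition (remove_hook \<nu> (r, c))"
    and "maya (remove_hook \<nu> (r, c)) = insert (gap \<nu> c) (maya \<nu> - {bead \<nu> r})"
    and "sum_list (remove_hook \<nu> (r, c)) < sum_list \<nu>"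
proof -
  have srt: "sorted_wrt (\<ge>) \<nu>" using \<nu> by (simp add: is_partition_def)
  define f where "f = col_len \<nu> c"
  define g where "g i = (if r \<le> i \<and> i < f then row_len \<nu> (i + 1) - 1 else if i = f then c - 1 else row_len \<nu> i)" for i
  define l where "l = map g [1..<length \<nu> + 1]"
  have rm: "remove_hook \<nu> (r, c) = filter (\<lambda>x. 0 < x) l"
    unfolding remove_hook_def l_def g_def[abs_def] f_def case_prod_conv ..
  have rc: "1 \<le> r" "1 \<le> c" "c \<le> row_len \<nu> r" using z by (auto simp: young_diagram_iff)
  have col: "c \<le> row_len \<nu> s \<longleftrightarrow> s \<le> f" if "1 \<le> s" for s
    using le_row_len_iff[OF srt that rc(2)] by (simp add: f_def)
  have f: "r \<le> f" "1 \<le> f" "f \<le> length \<nu>"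
    using col[of r] col[of f] rc row_len_beyond[of \<nu> f] by (auto simp: not_less[symmetric])
  have len: "length l = length \<nu>" by (simp add: l_def del: upt_Suc)
  have row: "row_len l i = g i" if "1 \<le> i" for i
  proof (cases "i \<le> length \<nu>")
    case True
    then show ?thesis using that by (simp add: row_len_def len, simp add: l_def del: upt_Suc)
  next
    case False
    then show ?thesis using f by (simp add: row_len_beyond len g_def)
  qed
  have anti: "row_len \<nu> (Suc i) \<le> row_len \<nu> i" if "1 \<le> i" for i
    using row_len_antimono[OF srt that, of "Suc i"] by simp
  have "g (Suc i) \<le> g i" if i: "1 \<le> i" for i
  proof -
    consider "Suc i < r" | "Suc i = r" | "r \<le> i" "Suc i < f" | "r \<le> i" "Suc i = f" | "i = f" | "f < i"
      using f(1) by linarith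
    then show ?thesis
    proof cases
      case 2
      then show ?thesis using anti[OF i] anti[of "Suc i"] col[of "Suc i"] f unfolding g_def by auto
    next
      case 3
      then show ?thesis using anti[of "Suc i"] unfolding g_def by auto
    next
      case 4
      then show ?thesis using col[of f] f unfolding g_def by auto
    next
      case 5
      then show ?thesis using col[of "Suc i"] f unfolding g_def by auto
    qed (use anti[OF i] f in \<open>auto simp: g_def\<close>)
  qed
  then have sl: "sorted_wrt (\<ge>) l" by (intro sorted_from_row_len) (simp add: row)
  show "is_partition (remove_hook \<nu> (r, c))" unfolding rm by (rule is_partition_filter_pos[OF sl])
  have bead': "bead (remove_hook \<nu> (r, c)) i = (if r \<le> i \<and> i < f then bead \<nu> (Suc i) else if i = f then gap \<nu> c else bead \<nu> i)"
    if "1 \<le> i" for i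
  proof -
    \<comment> \<open>Keeps the natural subtraction in \<open>g\<close> exact for the rows that move
      up.\<close>
    have "1 \<le> row_len \<nu> (Suc i)" if "i < f" using col[of "Suc i"] that rc by auto
    then show ?thesis using row[OF that] rc
      by (auto simp: bead_def rm row_len_filter_pos[OF sl] g_def gap_def f_def[symmetric])
  qed
  show "maya (remove_hook \<nu> (r, c)) = insert (gap \<nu> c) (maya \<nu> - {bead \<nu> r})"
  proof (intro set_eqI iffI)
    fix x assume "x \<in> maya (remove_hook \<nu> (r, c))"
    then obtain i where i: "1 \<le> i" "x = bead (remove_hook \<nu> (r, c)) i" by (auto simp: maya_def)
    then consider "r \<le> i" "i < f" "x = bead \<nu> (Suc i)" | "x = gap \<nu> c" | "i < r \<or> f < i" "x = bead \<nu> i"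
      using bead'[OF i(1)] by (auto split: if_splits)
    then show "x \<in> insert (gap \<nu> c) (maya \<nu> - {bead \<nu> r})"
    proof cases
      case 1
      then show ?thesis using bead_eq_iff[OF srt, of "Suc i" r] rc by (auto simp: maya_def)
    next
      case 3
      then show ?thesis using bead_eq_iff[OF srt, of i r] rc i f by (auto simp: maya_def)
    qed simp
  next
    fix x assume "x \<in> insert (gap \<nu> c) (maya \<nu> - {bead \<nu> r})"
    then consider "x = gap \<nu> c" | i where "1 \<le> i" "i \<noteq> r" "x = bead \<nu> i" by (auto simp: maya_def)
    then show "x \<in> maya (remove_hook \<nu> (r, c))"
    proof cases
      case 1
      then have "x = bead (remove_hook \<nu> (r, c)) f" using bead'[OF f(2)] by simp
      then show ?thesis using f by (auto simp: maya_def)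
    next
      case (2 i)
      show ?thesis
      proof (cases "r < i \<and> i \<le> f")
        case True
        then have "x = bead (remove_hook \<nu> (r, c)) (i - 1)" using bead'[of "i - 1"] 2 rc by auto
        then show ?thesis using True rc by (auto simp: maya_def)
      next
        case False
        then have "x = bead (remove_hook \<nu> (r, c)) i" using bead'[of i] 2 f by auto
        then show ?thesis using 2 by (auto simp: maya_def)
      qed
    qed
  qed
  have gle: "g i \<le> row_len \<nu> i" if "1 \<le> i" for i
    using anti[OF that] col[OF that] unfolding g_def by auto
  have gr: "g r < row_len \<nu> r" using anti[OF rc(1)] rc f unfolding g_def by auto
  have "sum_list (remove_hook \<nu> (r, c)) = sum_list l"
    unfolding rm by (induction l) auto
  also have "\<dots> = (\<Sum>i\<in>{1..<length \<nu> + 1}. g i)"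
    unfolding l_def by (simp add: sum_list_distinct_conv_sum_set del: upt_Suc)
  also have "\<dots> < (\<Sum>i\<in>{1..<length \<nu> + 1}. row_len \<nu> i)"
    by (rule sum_strict_mono_ex1) (use gle gr rc f in auto)
  also have "\<dots> = sum_list (map (row_len \<nu>) [1..<length \<nu> + 1])"
    by (simp add: sum_list_distinct_conv_sum_set del: upt_Suc)
  also have "map (row_len \<nu>) [1..<length \<nu> + 1] = \<nu>"
    by (rule nth_equalityI) (auto simp: row_len_def simp del: upt_Suc)
  finally show "sum_list (remove_hook \<nu> (r, c)) < sum_list \<nu>" .
qed

text \<open>Serves hook cores and bar cores alike: \<open>I\<close> is an invariant,
  \<open>F\<close> marks the terminal states, \<open>f\<close> is a decreasing measure.\<close>

lemma rtranclp_final_exists: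
  fixes f :: "'a \<Rightarrow> nat"
  assumes "\<And>x. I x \<Longrightarrow> \<not> F x \<Longrightarrow> \<exists>y. R x y \<and> I y \<and> f y < f x" and "I x"
  shows "\<exists>y. R\<^sup>*\<^sup>* x y \<and> F y"
  using assms(2)
proof (induction "f x" arbitrary: x rule: less_induct)
  case less
  show ?case
  proof (cases "F x")
    case False
    then obtain y where "R x y" "I y" "f y < f x" using assms(1) less.prems by blast
    then show ?thesis using less.hyps[of y] by (meson converse_rtranclp_into_rtranclp)
  qed auto
qed

lemma charge_lessThan [simp]: "charge d {..<0} i = 0"
proof -
  have "{x \<in> {..<0}. 0 \<le> x \<and> x mod d = i mod d} = {}"
    "{x. x \<notin> {..<0} \<and> x < 0 \<and> x mod d = i mod d} = {}" by auto
  then show ?thesis unfolding charge_def by (simp only: card.empty)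
qed

lemma normalized_lessThan: "normalized d {..<0} = {..<0}"
  unfolding normalized_def by auto

text \<open>Each removal moves a bead inside its class and keeps all charges. A terminal diagram
  normalizes to the negative integers, so it is determined by the charges; this makes the core
  unique, and empty exactly when all charges vanish.\<close>

lemma hook_core_eq_Nil_iff:
  assumes d: "0 < d" and \<nu>: "is_partition \<nu>"
  shows "hook_core d \<nu> = [] \<longleftrightarrow> (\<forall>i. charge (int d) (maya \<nu>) i = 0)"
proof -
  define R where "R = (\<lambda>\<nu>1 \<nu>2. \<exists>z \<in> young_diagram \<nu>1. d dvd hook_length \<nu>1 z \<and> \<nu>2 = remove_hook \<nu>1 z)"
  define F where "F \<kappa> \<longleftrightarrow> (\<forall>z \<in> young_diagram \<kappa>. \<not> d dvd hook_length \<kappa> z)" for \<kappa>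
  have core: "hook_core d \<nu> = (THE \<kappa>. R\<^sup>*\<^sup>* \<nu> \<kappa> \<and> F \<kappa>)"
    unfolding hook_core_def R_def F_def by simp
  have step: "is_partition y \<and> (\<forall>i. charge (int d) (maya y) i = charge (int d) (maya x) i) \<and> sum_list y < sum_list x"
    if Rxy: "R x y" and "is_partition x" for x y
  proof -
    obtain r c where z: "(r, c) \<in> young_diagram x" "d dvd hook_length x (r, c)" "y = remove_hook x (r, c)"
      using Rxy unfolding R_def by (metis surj_pair)
    have srt: "sorted_wrt (\<ge>) x" using that by (simp add: is_partition_def)
    have "int d dvd bead x r - gap x c"
      using z(2) int_hook_length[OF srt z(1)] by (metis int_dvd_int_iff)
    then have "bead x r mod int d = gap x c mod int d" by (simp add: mod_eq_dvd_iff)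
    moreover have "bead x r \<in> maya x" "gap x c \<notin> maya x"
      using z(1) Compl_maya[OF srt] by (auto simp: maya_def young_diagram_iff)
    ultimately show ?thesis
      using remove_hook[OF that(2) z(1)] charge_move[OF maya_set_maya[OF srt]] unfolding z(3) by simp
  qed
  have reach: "is_partition y \<and> (\<forall>i. charge (int d) (maya y) i = charge (int d) (maya \<nu>) i)" if "R\<^sup>*\<^sup>* \<nu> y" for y
    using that by (induction rule: rtranclp_induct) (use \<nu> step in auto)
  have norm: "normalized (int d) (maya y) = {..<0}" if "is_partition y" "F y" for y
  proof (rule flush_normalized)
    have srt: "sorted_wrt (\<ge>) y" using that by (simp add: is_partition_def)
    show "maya_set (maya y)" by (rule maya_set_maya[OF srt])
    fix x w assume a: "x \<in> maya y" "w \<notin> maya y" "w < x"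
    then obtain r where r: "1 \<le> r" "x = bead y r" by (auto simp: maya_def)
    obtain c where c: "1 \<le> c" "w = gap y c" using a Compl_maya[OF srt] by blast
    have z: "(r, c) \<in> young_diagram y" using gap_less_bead_iff(1)[OF srt r(1) c(1)] a r c by simp
    then have "\<not> d dvd hook_length y (r, c)" using that by (auto simp: F_def)
    then show "\<not> int d dvd x - w" using int_hook_length[OF srt z] r c by (metis int_dvd_int_iff)
  qed (use d in simp)
  have uniq: "y = y'" if "R\<^sup>*\<^sup>* \<nu> y" "R\<^sup>*\<^sup>* \<nu> y'" "F y" "F y'" for y y'
  proof (rule maya_inject)
    show p: "is_partition y" "is_partition y'" using reach that by auto
    show "maya y = maya y'"
      by (rule eq_if_normalized_eq[of "int d"])
        (use reach[OF that(1)] reach[OF that(2)] norm that p in auto)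
  qed
  have "\<exists>y. R\<^sup>*\<^sup>* \<nu> y \<and> F y"
  proof (rule rtranclp_final_exists[of is_partition F R sum_list])
    show "\<exists>y. R x y \<and> is_partition y \<and> sum_list y < sum_list x" if px: "is_partition x" and nF: "\<not> F x" for x
    proof -
      obtain z where "z \<in> young_diagram x" "d dvd hook_length x z" using nF by (auto simp: F_def)
      then have "R x (remove_hook x z)" by (auto simp: R_def)
      then show ?thesis using step px by blast
    qed
  qed (rule \<nu>)
  then obtain \<kappa> where \<kappa>: "R\<^sup>*\<^sup>* \<nu> \<kappa>" "F \<kappa>" by blast
  then have "hook_core d \<nu> = \<kappa>" unfolding core using uniq by (intro the_equality) auto
  moreover have "\<kappa> = [] \<longleftrightarrow> (\<forall>i. charge (int d) (maya \<nu>) i = 0)"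
  proof
    assume "\<kappa> = []"
    then show "\<forall>i. charge (int d) (maya \<nu>) i = 0" using reach[OF \<kappa>(1)] by (simp add: maya_Nil)
  next
    assume c: "\<forall>i. charge (int d) (maya \<nu>) i = 0"
    have "maya \<kappa> = maya []"
      unfolding maya_Nil
      by (rule eq_if_normalized_eq[of "int d"])
        (use reach[OF \<kappa>(1)] c norm[of \<kappa>] \<kappa>(2) in \<open>auto simp: normalized_lessThan\<close>)
    then show "\<kappa> = []" using maya_inject[of \<kappa> "[]"] reach[OF \<kappa>(1)] by (simp add: is_partition_def)
  qed
  ultimately show ?thesis by simp
qed

section \<open>Quotients\<close>

text \<open>Counting from 0, the \<open>i\<close>-th smallest element of \<open>X\<close> has
  \<open>i\<close> elements of \<open>X\<close> below it. With \<open>k\<close> the size of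
  \<open>X\<close>, the beads of the first \<open>k\<close> rows are therefore the elements of
  \<open>X\<close> lowered by \<open>k\<close>, and the empty rows after them supply all positions
  below \<open>- k\<close>.\<close>

lemma partition_of_beta_set:
  assumes "finite X"
  shows "is_partition (partition_of_beta_set X)"
    and "maya (partition_of_beta_set X) = {z. z + int (card X) \<in> int ` X \<or> z + int (card X) < 0}"
proof -
  define k where "k = card X"
  define s where "s = sorted_list_of_set X"
  have s: "length s = k" "set s = X" "sorted_wrt (<) s" "distinct s"
    using assms by (auto simp: s_def k_def)
  define f where "f x = x - card {y \<in> X. y < x}" for x
  define l where "l = map f (rev s)"
  have pX: "partition_of_beta_set X = filter (\<lambda>x. 0 < x) l"
    by (simp add: partition_of_beta_set_def l_def f_def[abs_def] s_def)
  have below: "card {y \<in> X. y < s ! i} = i" if "i < k" for i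
  proof -
    have "{y \<in> X. y < s ! i} = (!) s ` {..<i}"
    proof (intro set_eqI iffI)
      fix y assume y: "y \<in> {y \<in> X. y < s ! i}"
      then obtain j where j: "j < k" "y = s ! j" using s by (metis (no_types, lifting) in_set_conv_nth mem_Collect_eq)
      have "j < i"
      proof (rule ccontr)
        assume "\<not> j < i"
        then have "s ! i \<le> s ! j" using sorted_wrt_nth_less[OF s(3), of i j] j s by (cases "i = j") auto
        then show False using y j by simp
      qed
      then show "y \<in> (!) s ` {..<i}" using j by auto
    next
      fix y assume "y \<in> (!) s ` {..<i}"
      then show "y \<in> {y \<in> X. y < s ! i}"
        using sorted_wrt_nth_less[OF s(3)] that s by auto
    qed
    moreover have "inj_on ((!) s) {..<i}" using s that by (auto simp: inj_on_def nth_eq_iff_index_eq)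
    ultimately show ?thesis by (simp add: card_image)
  qed
  have ge: "i \<le> s ! i" if "i < k" for i
  proof -
    have "card {y \<in> X. y < s ! i} \<le> card {..<s ! i}" by (rule card_mono) auto
    then show ?thesis using below[OF that] by simp
  qed
  have row: "row_len l r = s ! (k - r) - (k - r)" if "1 \<le> r" "r \<le> k" for r
    using that s below[of "k - r"] by (simp add: row_len_def l_def rev_nth f_def)
  have len: "length l = k" using s by (simp add: l_def)
  have srt: "sorted_wrt (\<ge>) l"
  proof (rule sorted_from_row_len)
    fix r assume r: "1 \<le> r" "Suc r \<le> length l"
    have "s ! (k - Suc r) < s ! (k - r)"
      by (rule sorted_wrt_nth_less[OF s(3)]) (use r s len in auto)
    then show "row_len l (Suc r) \<le> row_len l r"
      using r len by (simp add: row)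
  qed
  show "is_partition (partition_of_beta_set X)" unfolding pX by (rule is_partition_filter_pos[OF srt])
  have b: "bead (partition_of_beta_set X) r = (if r \<le> k then int (s ! (k - r)) - int k else - int r)" if "1 \<le> r" for r
    using that row[OF that] ge[of "k - r"]
    by (auto simp: bead_def pX row_len_filter_pos[OF srt] row_len_beyond len of_nat_diff)
  show "maya (partition_of_beta_set X) = {z. z + int (card X) \<in> int ` X \<or> z + int (card X) < 0}"
    unfolding k_def[symmetric]
  proof (intro set_eqI iffI)
    fix z assume "z \<in> maya (partition_of_beta_set X)"
    then obtain r where r: "1 \<le> r" "z = bead (partition_of_beta_set X) r" by (auto simp: maya_def)
    then show "z \<in> {z. z + int k \<in> int ` X \<or> z + int k < 0}"
      using b[OF r(1)] s nth_mem[of "k - r" s] by auto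
  next
    fix z assume "z \<in> {z. z + int k \<in> int ` X \<or> z + int k < 0}"
    then consider "z + int k \<in> int ` X" | "z + int k < 0" by blast
    then show "z \<in> maya (partition_of_beta_set X)"
    proof cases
      case 1
      then obtain j where j: "j < k" "z + int k = int (s ! j)" using s by (metis (no_types, lifting) imageE in_set_conv_nth)
      then have "1 \<le> k - j" "z = bead (partition_of_beta_set X) (k - j)" using b[of "k - j"] by auto
      then show ?thesis by (auto simp: maya_def)
    next
      case 2
      then have "1 \<le> nat (- z)" "z = bead (partition_of_beta_set X) (nat (- z))" using b[of "nat (- z)"] by auto
      then show ?thesis by (auto simp: maya_def)
    qed
  qed
qed

text \<open>The beta-set is the diagram raised by the multiple \<open>d * K\<close> of
  \<open>d\<close> and cut off at 0. As \<open>length \<nu> \<le> d * K\<close>, the part cut off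
  consists of beads only.\<close>

lemma beta_set_maya:
  assumes "0 < d"
  obtains K where "length \<nu> \<le> d * K" "\<And>x. x \<in> beta_set d \<nu> \<longleftrightarrow> int x - int d * int K \<in> maya \<nu>"
proof -
  define k where "k = (LEAST k. d dvd k \<and> length \<nu> \<le> k)"
  have "d dvd k \<and> length \<nu> \<le> k"
    unfolding k_def by (rule LeastI[of _ "d * length \<nu>"]) (use assms in simp)
  then obtain K where K: "k = d * K" "length \<nu> \<le> k" by (auto elim: dvdE)
  have bs: "beta_set d \<nu> = {row_len \<nu> s + k - s | s. 1 \<le> s \<and> s \<le> k}"
    by (simp add: beta_set_def Let_def k_def)
  have "x \<in> beta_set d \<nu> \<longleftrightarrow> int x - int k \<in> maya \<nu>" for x
  proof
    assume "x \<in> beta_set d \<nu>"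
    then obtain s where "1 \<le> s" "s \<le> k" "x = row_len \<nu> s + k - s" by (auto simp: bs)
    then have "int x - int k = bead \<nu> s" "1 \<le> s" by (auto simp: bead_def of_nat_diff)
    then show "int x - int k \<in> maya \<nu>" by (auto simp: maya_def)
  next
    assume "int x - int k \<in> maya \<nu>"
    then obtain s where s: "1 \<le> s" "int x - int k = bead \<nu> s" by (auto simp: maya_def)
    have "s \<le> k" using s row_len_beyond[of \<nu> s] K(2) by (cases "s \<le> k") (auto simp: bead_def)
    then have "x = row_len \<nu> s + k - s" using s by (auto simp: bead_def)
    then show "x \<in> beta_set d \<nu>" using s \<open>s \<le> k\<close> by (auto simp: bs)
  qed
  then show ?thesis using that[of K] K by simp
qed

text \<open>Bead counts on the runners are the charges plus a common constant \<open>K\<close>, so a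
  difference of bead counts is a difference of charges.\<close>

lemma runner_maya:
  assumes d: "0 < d" and srt: "sorted_wrt (\<ge>) \<nu>"
  obtains K where "length \<nu> \<le> d * K"
    "\<And>x i. x \<in> runner d \<nu> i \<longleftrightarrow> int x - int d * int K \<in> maya \<nu> \<and> x mod d = i"
    "\<And>i. i < d \<Longrightarrow> finite (runner d \<nu> i)"
    "\<And>i. i < d \<Longrightarrow> int (card (runner d \<nu> i)) = int K + charge (int d) (maya \<nu>) (int i)"
proof -
  obtain K where K: "length \<nu> \<le> d * K" "\<And>x. x \<in> beta_set d \<nu> \<longleftrightarrow> int x - int d * int K \<in> maya \<nu>"
    using beta_set_maya[OF d] by blast
  have run: "x \<in> runner d \<nu> i \<longleftrightarrow> int x - int d * int K \<in> maya \<nu> \<and> x mod d = i" for x i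
    using K(2) by (auto simp: runner_def)
  define T where "T = {x. x + int d * (- int K) \<in> maya \<nu>}"
  have T: "maya_set T" unfolding T_def by (rule maya_set_shift_uniform[OF maya_set_maya[OF srt]])
  have ch: "charge (int d) T i = charge (int d) (maya \<nu>) i + int K" for i
    unfolding T_def using charge_shift_uniform[OF maya_set_maya[OF srt], of "int d" "- int K" i] d by simp
  have neg: "x \<in> T" if "x < 0" for x
  proof -
    have "x + int d * (- int K) < - int (length \<nu>)"
      using that K(1) by (simp flip: of_nat_mult)
    then show ?thesis unfolding T_def using below_length_in_maya by simp
  qed
  have im: "int ` runner d \<nu> i = {x \<in> T. 0 \<le> x \<and> x mod int d = int i mod int d}" if "i < d" for i
  proof (intro set_eqI iffI)
    fix x assume "x \<in> int ` runner d \<nu> i"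
    then show "x \<in> {x \<in> T. 0 \<le> x \<and> x mod int d = int i mod int d}"
      using that by (auto simp: run T_def simp flip: of_nat_mod)
  next
    fix x assume x: "x \<in> {x \<in> T. 0 \<le> x \<and> x mod int d = int i mod int d}"
    then have "int (nat x mod d) = int (i mod d)" by (simp add: of_nat_mod)
    then have "nat x mod d = i" using that by simp
    then have "nat x \<in> runner d \<nu> i" using x by (simp add: run T_def)
    then show "x \<in> int ` runner d \<nu> i" using x by (intro image_eqI[of _ _ "nat x"]) auto
  qed
  have fin: "finite (runner d \<nu> i)" if "i < d" for i
  proof -
    have "finite (int ` runner d \<nu> i)" unfolding im[OF that] by (rule finite_maya_nonneg[OF T])
    then show ?thesis by (rule finite_imageD) simp
  qed
  have "int (card (runner d \<nu> i)) = int K + charge (int d) (maya \<nu>) (int i)" if "i < d" for i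
  proof -
    have "{x. x \<notin> T \<and> x < 0 \<and> x mod int d = int i mod int d} = {}" using neg by blast
    then have "charge (int d) T (int i) = int (card (int ` runner d \<nu> i))"
      unfolding charge_def im[OF that] by (simp only: card.empty)
    then show ?thesis using ch[of "int i"] by (simp add: card_image)
  qed
  then show ?thesis using that K run fin by blast
qed

text \<open>Runner \<open>i\<close> has \<open>K + t\<close> beads, with \<open>t\<close> the charge
  of its class. Centring the component at its number of beads removes \<open>K\<close> and
  \<open>t\<close> together, and this is the normalization of the class.\<close>

lemma quotient_maya:
  assumes d: "0 < d" and srt: "sorted_wrt (\<ge>) \<nu>" and i: "i < d"
  shows "is_partition (quotient d \<nu> ! i)"
    and "maya (quotient d \<nu> ! i) = {z. int d * z + int i \<in> normalized (int d) (maya \<nu>)}"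
proof -
  obtain K where K: "length \<nu> \<le> d * K"
    "\<And>x i. x \<in> runner d \<nu> i \<longleftrightarrow> int x - int d * int K \<in> maya \<nu> \<and> x mod d = i"
    "\<And>i. i < d \<Longrightarrow> finite (runner d \<nu> i)"
    "\<And>i. i < d \<Longrightarrow> int (card (runner d \<nu> i)) = int K + charge (int d) (maya \<nu>) (int i)"
    using runner_maya[OF d srt] by blast
  define X where "X = (\<lambda>x. (x - i) div d) ` runner d \<nu> i"
  define t where "t = charge (int d) (maya \<nu>) (int i)"
  have q: "quotient d \<nu> ! i = partition_of_beta_set X" using i by (simp add: quotient_def X_def)
  have fin: "finite X" using K(3)[OF i] by (simp add: X_def)
  show "is_partition (quotient d \<nu> ! i)" unfolding q by (rule partition_of_beta_set(1)[OF fin])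
  have X: "y \<in> X \<longleftrightarrow> d * y + i \<in> runner d \<nu> i" for y
  proof
    assume "y \<in> X"
    then obtain x where x: "x \<in> runner d \<nu> i" "y = (x - i) div d" by (auto simp: X_def)
    then have "x mod d = i" using K(2) by blast
    then have "x = d * (x div d) + i" using mult_div_mod_eq[of d x] by simp
    then have "y = x div d" unfolding x(2) using d by (metis add_diff_cancel_right' nonzero_mult_div_cancel_left not_gr_zero)
    then show "d * y + i \<in> runner d \<nu> i" using x(1) \<open>x = d * (x div d) + i\<close> by simp
  next
    assume "d * y + i \<in> runner d \<nu> i"
    then have "(d * y + i - i) div d \<in> X" unfolding X_def by (rule imageI)
    then show "y \<in> X" using d by simp
  qed
  have "card X = card (runner d \<nu> i)"
  proof -
    have "runner d \<nu> i = (\<lambda>y. d * y + i) ` X"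
    proof (intro set_eqI iffI)
      fix x assume x: "x \<in> runner d \<nu> i"
      then have "x mod d = i" using K(2) by blast
      then have xx: "x = d * (x div d) + i" using mult_div_mod_eq[of d x] by simp
      then have "x div d \<in> X" using x X by simp
      then show "x \<in> (\<lambda>y. d * y + i) ` X" using xx by (intro image_eqI)
    qed (use X in auto)
    then show ?thesis using d by (simp add: card_image inj_on_def)
  qed
  then have cX: "int (card X) = int K + t" using K(4)[OF i] by (simp add: t_def)
  have "z \<in> maya (partition_of_beta_set X) \<longleftrightarrow> int d * z + int i + int d * t \<in> maya \<nu>" for z
  proof (cases "z + int (card X) < 0")
    case True
    \<comment> \<open>Here both sides hold: \<open>z\<close> lies below the runner, and the matching
      position lies below \<open>- length \<nu>\<close>, where all positions are beads.\<close>
    have "int d * z + int i + int d * t < - int (length \<nu>)"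
    proof -
      have "z + t \<le> - int K - 1" using True cX by simp
      then have "int d * (z + t) \<le> int d * (- int K - 1)" by (intro mult_left_mono) auto
      then have "int d * z + int d * t + int d \<le> - (int d * int K)" by (simp add: algebra_simps)
      moreover have "int (length \<nu>) \<le> int d * int K" using K(1) by (simp flip: of_nat_mult)
      ultimately show ?thesis using i by linarith
    qed
    then show ?thesis using True below_length_in_maya unfolding partition_of_beta_set(2)[OF fin] by simp
  next
    case False
    define y where "y = nat (z + int (card X))"
    have y: "int y = z + int K + t" using False cX by (simp add: y_def)
    have yc: "z + int (card X) = int y" using False by (simp add: y_def)
    have "z \<in> maya (partition_of_beta_set X) \<longleftrightarrow> y \<in> X"
      unfolding partition_of_beta_set(2)[OF fin] mem_Collect_eq yc by auto
    also have "\<dots> \<longleftrightarrow> int (d * y + i) - int d * int K \<in> maya \<nu>" using X K(2) i by simp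
    also have "int (d * y + i) - int d * int K = int d * z + int i + int d * t"
      by (simp add: y algebra_simps)
    finally show ?thesis .
  qed
  moreover have "charge (int d) (maya \<nu>) (int d * z + int i) = t" for z
    unfolding t_def by (rule charge_cong) simp
  ultimately show "maya (quotient d \<nu> ! i) = {z. int d * z + int i \<in> normalized (int d) (maya \<nu>)}"
    unfolding q normalized_def by auto
qed

text \<open>Each integer is \<open>d * z + i\<close> for exactly one pair with
  \<open>0 \<le> i < d\<close>, so the components of the quotient together encode the normalized
  diagram.\<close>

lemma quotient_eq_iff:
  assumes d: "0 < d" and srt: "sorted_wrt (\<ge>) \<nu>" "sorted_wrt (\<ge>) \<nu>'"
  shows "quotient d \<nu> = quotient d \<nu>' \<longleftrightarrow> normalized (int d) (maya \<nu>) = normalized (int d) (maya \<nu>')"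
proof
  assume q: "quotient d \<nu> = quotient d \<nu>'"
  show "normalized (int d) (maya \<nu>) = normalized (int d) (maya \<nu>')"
  proof (rule set_eqI)
    fix x :: int
    define i where "i = nat (x mod int d)"
    have i: "i < d" "int i = x mod int d" using d by (auto simp: i_def nat_less_iff)
    have x: "int d * (x div int d) + int i = x" by (simp add: i)
    have "x \<in> normalized (int d) (maya \<nu>) \<longleftrightarrow> x div int d \<in> maya (quotient d \<nu> ! i)"
      unfolding quotient_maya(2)[OF d srt(1) i(1)] mem_Collect_eq x ..
    also have "\<dots> \<longleftrightarrow> x \<in> normalized (int d) (maya \<nu>')"
      unfolding q quotient_maya(2)[OF d srt(2) i(1)] mem_Collect_eq x ..
    finally show "x \<in> normalized (int d) (maya \<nu>) \<longleftrightarrow> x \<in> normalized (int d) (maya \<nu>')" .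
  qed
next
  assume n: "normalized (int d) (maya \<nu>) = normalized (int d) (maya \<nu>')"
  show "quotient d \<nu> = quotient d \<nu>'"
  proof (rule nth_equalityI)
    fix i assume "i < length (quotient d \<nu>)"
    then have i: "i < d" by (simp add: quotient_def)
    show "quotient d \<nu> ! i = quotient d \<nu>' ! i"
      by (rule maya_inject) (use quotient_maya[OF d srt(1) i] quotient_maya[OF d srt(2) i] n in auto)
  qed (simp add: quotient_def)
qed

section \<open>Bar partitions\<close>

definition bar_maya :: "nat set \<Rightarrow> int set" where
  "bar_maya A = {x. (0 < x \<and> nat x \<in> A) \<or> (x < 0 \<and> nat (- x) \<notin> A)}"

lemma bar_symmetric_bar_maya: "bar_symmetric (bar_maya A)"
  unfolding bar_symmetric_def bar_maya_def by auto

lemma maya_set_bar_maya: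
  assumes "finite A" shows "maya_set (bar_maya A)"
proof -
  obtain N where N: "\<And>a. a \<in> A \<Longrightarrow> a < N" using assms by (meson finite_nat_set_iff_bounded)
  have "nat x \<notin> A" if "int N \<le> x" for x using that N[of "nat x"] by fastforce
  moreover have "nat (- x) \<notin> A" if "x < - int N" for x using that N[of "nat (- x)"] by fastforce
  ultimately show ?thesis
    unfolding maya_set_def bar_maya_def by (intro exI[of _ "int N"]) auto
qed

lemma bar_maya_inject:
  assumes "0 \<notin> A" "0 \<notin> B" "bar_maya A = bar_maya B" shows "A = B"
proof (rule set_eqI)
  fix a :: nat
  show "a \<in> A \<longleftrightarrow> a \<in> B"
  proof (cases "a = 0")
    case False
    have "int a \<in> bar_maya C \<longleftrightarrow> a \<in> C" for C using False by (auto simp: bar_maya_def)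
    then show ?thesis using assms(3) by blast
  qed (use assms in simp)
qed

lemma bar_maya_insert:
  "0 < a \<Longrightarrow> bar_maya (insert a A) = insert (int a) (bar_maya A - {- int a})"
  by (auto simp: bar_maya_def)

lemma charge_bar_insert:
  assumes "finite A" "0 < a" "a \<notin> A"
  shows "charge d (bar_maya (insert a A)) i = charge d (bar_maya A) i
    + of_bool (int a mod d = i mod d) - of_bool (- int a mod d = i mod d)"
proof -
  note M = maya_set_bar_maya[OF assms(1)]
  have "- int a \<in> bar_maya A" "int a \<notin> bar_maya A" using assms by (auto simp: bar_maya_def)
  then show ?thesis
    unfolding bar_maya_insert[OF assms(2)]
    using charge_insert[OF maya_set_remove[OF M], of "int a" "- int a" d i] charge_remove[OF M, of "- int a" d i]
    by simp
qed

lemma charge_bar_remove: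
  assumes "finite A" "0 < a" "a \<in> A"
  shows "charge d (bar_maya (A - {a})) i = charge d (bar_maya A) i
    - of_bool (int a mod d = i mod d) + of_bool (- int a mod d = i mod d)"
  using charge_bar_insert[of "A - {a}" a d i] assms by (simp add: insert_absorb)

section \<open>Bar partitions and the diagrams of their doubles\<close>

lemma bar_partition_exists:
  assumes "finite A" "0 \<notin> A" obtains \<mu> where "bar_partition \<mu>" "set \<mu> = A"
proof
  show "bar_partition (rev (sorted_list_of_set A))"
    using assms by (simp add: bar_partition_def sorted_wrt_rev)
  show "set (rev (sorted_list_of_set A)) = A" using assms by simp
qed

lemma bar_partition_eqI:
  assumes "bar_partition \<mu>" "bar_partition \<mu>'" "set \<mu> = set \<mu>'" shows "\<mu> = \<mu>'"
proof -
  have "sorted_wrt (<) (rev \<mu>)" "sorted_wrt (<) (rev \<mu>')"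
    using assms by (auto simp: bar_partition_def sorted_wrt_rev)
  then have "rev \<mu> = rev \<mu>'" using assms(3) by (metis set_rev strict_sorted_equal)
  then show ?thesis by simp
qed

lemma bar_partition_maya_inject:
  assumes "bar_partition \<mu>" "bar_partition \<mu>'" "bar_maya (set \<mu>) = bar_maya (set \<mu>')" shows "\<mu> = \<mu>'"
  using assms bar_maya_inject by (intro bar_partition_eqI) (auto simp: bar_partition_def)

lemma bar_partition_set:
  assumes "bar_partition \<mu>"
  shows "set \<mu> = row_len \<mu> ` {1..length \<mu>}" and "inj_on (row_len \<mu>) {1..length \<mu>}"
    and "\<And>r s. 1 \<le> r \<Longrightarrow> r \<le> length \<mu> \<Longrightarrow> 1 \<le> s \<Longrightarrow> s \<le> length \<mu> \<Longrightarrow> row_len \<mu> s < row_len \<mu> r \<longleftrightarrow> r < s"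
    and "\<And>r. 1 \<le> r \<Longrightarrow> r \<le> length \<mu> \<Longrightarrow> 0 < row_len \<mu> r"
proof -
  show s: "set \<mu> = row_len \<mu> ` {1..length \<mu>}"
  proof (intro set_eqI iffI)
    fix a assume "a \<in> set \<mu>"
    then obtain i where "i < length \<mu>" "a = \<mu> ! i" by (auto simp: in_set_conv_nth)
    then show "a \<in> row_len \<mu> ` {1..length \<mu>}" by (intro image_eqI[of _ _ "Suc i"]) (auto simp: row_len_def)
  qed (auto simp: row_len_def)
  have less: "row_len \<mu> s < row_len \<mu> r" if "1 \<le> r" "r < s" "s \<le> length \<mu>" for r s
  proof -
    have "sorted_wrt (>) \<mu>" using assms by (simp add: bar_partition_def)
    from sorted_wrt_nth_less[OF this, of "r - 1" "s - 1"] show ?thesis using that by (simp add: row_len_def)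
  qed
  show iff: "row_len \<mu> s < row_len \<mu> r \<longleftrightarrow> r < s"
    if "1 \<le> r" "r \<le> length \<mu>" "1 \<le> s" "s \<le> length \<mu>" for r s
    using less[of r s] less[of s r] that by (metis less_asym linorder_neqE_nat order_less_irrefl)
  show "inj_on (row_len \<mu>) {1..length \<mu>}"
    by (rule inj_onI) (metis iff atLeastAtMost_iff linorder_neqE_nat less_irrefl)
  show "0 < row_len \<mu> r" if "1 \<le> r" "r \<le> length \<mu>" for r
  proof -
    have "row_len \<mu> r \<in> set \<mu>" using s that by auto
    then show ?thesis using assms unfolding bar_partition_def by (metis gr0I)
  qed
qed

text \<open>Rows below the first \<open>length \<mu>\<close> count columns among the first
  \<open>length \<mu>\<close>, hence are no longer than that: the Durfee square has side
  \<open>length \<mu>\<close>.\<close>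

lemma doubled_lower_rows:
  assumes "bar_partition \<mu>"
  shows "is_partition (doubled \<mu>)" and "length \<mu> < r \<Longrightarrow> row_len (doubled \<mu>) r \<le> length \<mu>"
proof -
  let ?m = "length \<mu>"
  let ?b = "map (\<lambda>a. a - 1) \<mu>"
  let ?L = "row_len \<mu> 1"
  let ?C = "\<lambda>s. {c. 1 \<le> c \<and> c \<le> ?m \<and> s \<le> row_len ?b c + c}"
  have "is_partition (doubled \<mu>) \<and> (?m < r \<longrightarrow> row_len (doubled \<mu>) r \<le> ?m)"
  proof (cases "\<mu> = []")
    case True
    then show ?thesis by (simp add: doubled_def partition_of_frobenius_def is_partition_def row_len_def)
  next
    case False
    then have m: "1 \<le> ?m" by (cases \<mu>) auto
    have L: "0 < ?L" "?m \<le> ?L"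
      using bar_partition_set(4)[OF assms, of 1] bar_partition_row_len(2)[OF assms, of 1 1] m by auto
    have "hd ?b + 2 = ?L + 1" using False L(1) by (cases \<mu>) (auto simp: row_len_def)
    then have D: "doubled \<mu> = map (\<lambda>s. if s \<le> ?m then row_len \<mu> s + s else card (?C s)) [1..<?L + 1]"
      using False unfolding doubled_def partition_of_frobenius_def by simp
    have len: "length (doubled \<mu>) = ?L" unfolding D by simp
    have row: "row_len (doubled \<mu>) s = (if s \<le> ?m then row_len \<mu> s + s else card (?C s))"
      if "1 \<le> s" "s \<le> ?L" for s
      using that unfolding row_len_def[of "doubled \<mu>"] len unfolding D
      by (simp del: upt_Suc add: nth_append)
    have fin: "finite (?C s)" for s by (rule finite_subset[of _ "{1..?m}"]) auto
    have Cm: "card (?C s) \<le> ?m" for s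
    proof -
      have "card (?C s) \<le> card {1..?m}" by (rule card_mono) auto
      then show ?thesis by simp
    qed
    have low: "row_len (doubled \<mu>) s \<le> ?m" if "?m < s" for s
      using row[of s] that Cm[of s] m row_len_beyond[of "doubled \<mu>" s] len by (cases "s \<le> ?L") auto
    have srt: "sorted_wrt (\<ge>) (doubled \<mu>)"
    proof (rule sorted_from_row_len)
      fix s assume s: "1 \<le> s" "Suc s \<le> length (doubled \<mu>)"
      consider "Suc s \<le> ?m" | "s = ?m" | "?m < s" by linarith
      then show "row_len (doubled \<mu>) (Suc s) \<le> row_len (doubled \<mu>) s"
      proof cases
        case 1
        then show ?thesis using row[of s] row[of "Suc s"] s len bar_partition_row_len(1)[OF assms, of s "Suc s"] by simp
      next
        case 2
        then show ?thesis using low[of "Suc s"] row[of s] s len by simp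
      next
        case 3
        have "card (?C (Suc s)) \<le> card (?C s)" by (rule card_mono[OF fin]) auto
        then show ?thesis using row[of s] row[of "Suc s"] s len 3 by simp
      qed
    qed
    have pos: "0 < row_len (doubled \<mu>) s" if "1 \<le> s" "s \<le> ?L" for s
    proof (cases "s \<le> ?m")
      case False
      have "row_len ?b 1 + 1 = ?L" using m L by (cases \<mu>) (auto simp: row_len_def)
      then have "1 \<in> ?C s" using that m by simp
      then have "0 < card (?C s)" using fin[of s] card_gt_0_iff by blast
      then show ?thesis using row[OF that] False by simp
    qed (use row[OF that] that in simp)
    have "0 \<notin> set (doubled \<mu>)"
    proof
      assume "0 \<in> set (doubled \<mu>)"
      then obtain i where i: "i < ?L" "doubled \<mu> ! i = 0" using len by (auto simp: in_set_conv_nth)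
      then show False using pos[of "Suc i"] len by (simp add: row_len_def)
    qed
    then show ?thesis using srt low by (simp add: is_partition_def)
  qed
  then show "is_partition (doubled \<mu>)" and "length \<mu> < r \<Longrightarrow> row_len (doubled \<mu>) r \<le> length \<mu>" by auto
qed

text \<open>Frobenius coordinates read on the diagram: arms are the beads at or above 0, and a leg
  \<open>a - 1\<close> gives the gap \<open>-1 - (a - 1) = - a\<close>. Column
  \<open>length \<mu> + 1\<close> has its gap at 0, so its hooks have the parts as lengths.\<close>

lemma doubled_beads:
  assumes \<mu>: "bar_partition \<mu>"
  shows "1 \<le> r \<Longrightarrow> r \<le> length \<mu> \<Longrightarrow> bead (doubled \<mu>) r = int (row_len \<mu> r)"
    and "length \<mu> < r \<Longrightarrow> bead (doubled \<mu>) r < 0"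
    and "1 \<le> c \<Longrightarrow> c \<le> length \<mu> \<Longrightarrow> gap (doubled \<mu>) c = - int (row_len \<mu> c)"
    and "length \<mu> < c \<Longrightarrow> 0 \<le> gap (doubled \<mu>) c"
    and "gap (doubled \<mu>) (length \<mu> + 1) = 0"
proof -
  have srt: "sorted_wrt (\<ge>) (doubled \<mu>)" using doubled_lower_rows(1)[OF \<mu>] by (simp add: is_partition_def)
  show "bead (doubled \<mu>) r = int (row_len \<mu> r)" if "1 \<le> r" "r \<le> length \<mu>"
    using doubled_row_col(1)[OF \<mu> that] by (simp add: bead_def)
  show "bead (doubled \<mu>) r < 0" if "length \<mu> < r"
    using doubled_lower_rows(2)[OF \<mu> that] that by (simp add: bead_def)
  show "gap (doubled \<mu>) c = - int (row_len \<mu> c)" if "1 \<le> c" "c \<le> length \<mu>"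
    using doubled_row_col(2)[OF \<mu> that] bar_partition_set(4)[OF \<mu> that] that by (simp add: gap_def of_nat_diff)
  have col: "col_len (doubled \<mu>) c \<le> length \<mu>" if "length \<mu> < c" for c
    using le_row_len_iff[OF srt, of "Suc (length \<mu>)" c] doubled_lower_rows(2)[OF \<mu>, of "Suc (length \<mu>)"] that
    by linarith
  show "0 \<le> gap (doubled \<mu>) c" if "length \<mu> < c"
    using col[OF that] that unfolding gap_def by linarith
  have "length \<mu> \<le> col_len (doubled \<mu>) (length \<mu> + 1)"
  proof (cases "length \<mu> = 0")
    case False
    then have "1 \<le> length \<mu>" by linarith
    then have "length \<mu> + 1 \<le> row_len (doubled \<mu>) (length \<mu>)"
      using doubled_row_col(1)[OF \<mu>, of "length \<mu>"] bar_partition_set(4)[OF \<mu>, of "length \<mu>"] by simp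
    then show ?thesis using le_row_len_iff[OF srt, of "length \<mu>" "length \<mu> + 1"] False by simp
  qed simp
  then show "gap (doubled \<mu>) (length \<mu> + 1) = 0" using col[of "length \<mu> + 1"] by (simp add: gap_def)
qed

lemma maya_doubled:
  assumes \<mu>: "bar_partition \<mu>" shows "maya (doubled \<mu>) = bar_maya (set \<mu>)"
proof (rule set_eqI)
  fix x :: int
  have srt: "sorted_wrt (\<ge>) (doubled \<mu>)" using doubled_lower_rows(1)[OF \<mu>] by (simp add: is_partition_def)
  note b = doubled_beads[OF \<mu>]
  have bm: "a \<in> set \<mu> \<longleftrightarrow> (\<exists>r. 1 \<le> r \<and> r \<le> length \<mu> \<and> a = row_len \<mu> r)" for a
    using bar_partition_set(1)[OF \<mu>] by auto
  show "x \<in> maya (doubled \<mu>) \<longleftrightarrow> x \<in> bar_maya (set \<mu>)"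
  proof (cases "0 \<le> x")
    case True
    have "x \<in> maya (doubled \<mu>) \<longleftrightarrow> (\<exists>r. 1 \<le> r \<and> r \<le> length \<mu> \<and> x = int (row_len \<mu> r))"
    proof
      assume "x \<in> maya (doubled \<mu>)"
      then obtain r where r: "1 \<le> r" "x = bead (doubled \<mu>) r" by (auto simp: maya_def)
      then have "r \<le> length \<mu>" using b(2)[of r] True by (cases "r \<le> length \<mu>") auto
      then show "\<exists>r. 1 \<le> r \<and> r \<le> length \<mu> \<and> x = int (row_len \<mu> r)" using r b(1) by auto
    next
      assume "\<exists>r. 1 \<le> r \<and> r \<le> length \<mu> \<and> x = int (row_len \<mu> r)"
      then show "x \<in> maya (doubled \<mu>)" using b(1) by (force simp: maya_def)
    qed
    also have "\<dots> \<longleftrightarrow> 0 < x \<and> nat x \<in> set \<mu>"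
      unfolding bm using bar_partition_set(4)[OF \<mu>] True by auto
    finally show ?thesis using True by (auto simp: bar_maya_def)
  next
    case False
    have "x \<notin> maya (doubled \<mu>) \<longleftrightarrow> (\<exists>r. 1 \<le> r \<and> r \<le> length \<mu> \<and> x = - int (row_len \<mu> r))"
    proof
      assume "x \<notin> maya (doubled \<mu>)"
      then obtain c where c: "1 \<le> c" "x = gap (doubled \<mu>) c" using Compl_maya[OF srt] by blast
      then have "c \<le> length \<mu>" using b(4)[of c] False by (cases "c \<le> length \<mu>") auto
      then show "\<exists>r. 1 \<le> r \<and> r \<le> length \<mu> \<and> x = - int (row_len \<mu> r)" using c b(3) by auto
    next
      assume "\<exists>r. 1 \<le> r \<and> r \<le> length \<mu> \<and> x = - int (row_len \<mu> r)"
      then obtain c where "1 \<le> c" "x = gap (doubled \<mu>) c" using b(3) by force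
      then have "x \<in> - maya (doubled \<mu>)" unfolding Compl_maya[OF srt] by auto
      then show "x \<notin> maya (doubled \<mu>)" by simp
    qed
    also have "\<dots> \<longleftrightarrow> nat (- x) \<in> set \<mu>"
      unfolding bm using False by auto
    finally show ?thesis using False by (auto simp: bar_maya_def)
  qed
qed

lemma image_mset_set_UN_disjoint:
  assumes "finite I" "\<And>i. i \<in> I \<Longrightarrow> finite (W i)" "\<And>i j. i \<in> I \<Longrightarrow> j \<in> I \<Longrightarrow> i \<noteq> j \<Longrightarrow> W i \<inter> W j = {}"
  shows "image_mset f (mset_set (\<Union>i\<in>I. W i)) = (\<Sum>i\<in>I. image_mset f (mset_set (W i)))"
  using assms
proof (induction I rule: finite_induct)
  case (insert i I)
  have "mset_set (W i \<union> (\<Union>j\<in>I. W j)) = mset_set (W i) + mset_set (\<Union>j\<in>I. W j)"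
  proof (rule mset_set_Union)
    show "W i \<inter> (\<Union>j\<in>I. W j) = {}" using insert.prems(2)[of i] insert.hyps by auto
  qed (use insert in auto)
  then show ?case using insert by simp
qed simp

text \<open>For the part \<open>a\<close> of row \<open>i\<close>, the gaps \<open>y\<close> with
  \<open>0 \<le> y < a\<close> give the lengths 1 to \<open>a\<close> without the differences from
  smaller parts, and the gaps at the negatives of smaller parts give the sums.\<close>

lemma bar_lengths_eq:
  assumes \<mu>: "bar_partition \<mu>"
  shows "bar_lengths \<mu> = pair_lengths id (bar_pairs (bar_maya (set \<mu>)))"
proof -
  let ?m = "length \<mu>"
  let ?M = "bar_maya (set \<mu>)"
  let ?a = "row_len \<mu>"
  note bp = bar_partition_set[OF \<mu>]
  define Y where "Y i = {y. y \<notin> ?M \<and> \<bar>y\<bar> < int (?a i)}" for i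
  define W where "W i = (\<lambda>y. (int (?a i), y)) ` Y i" for i
  have finY: "finite (Y i)" for i
    by (rule finite_subset[of _ "{- int (?a i)..int (?a i)}"]) (auto simp: Y_def)
  have pairs: "bar_pairs ?M = (\<Union>i\<in>{1..?m}. W i)"
  proof (intro set_eqI iffI)
    fix p assume "p \<in> bar_pairs ?M"
    then obtain x y where p: "p = (x, y)" "x \<in> ?M" "y \<notin> ?M" "\<bar>y\<bar> < x" by (auto simp: bar_pairs_def)
    then have "0 < x" "nat x \<in> set \<mu>" by (auto simp: bar_maya_def)
    then obtain i where "i \<in> {1..?m}" "x = int (?a i)" unfolding bp(1) by force
    then show "p \<in> (\<Union>i\<in>{1..?m}. W i)" using p by (auto simp: W_def Y_def)
  next
    fix p assume "p \<in> (\<Union>i\<in>{1..?m}. W i)"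
    then obtain i y where i: "i \<in> {1..?m}" "p = (int (?a i), y)" "y \<notin> ?M" "\<bar>y\<bar> < int (?a i)"
      by (auto simp: W_def Y_def)
    moreover have "int (?a i) \<in> ?M" using i(1) bp(1,4) by (auto simp: bar_maya_def)
    ultimately show "p \<in> bar_pairs ?M" by (auto simp: bar_pairs_def)
  qed
  have disj: "W i \<inter> W j = {}" if "i \<in> {1..?m}" "j \<in> {1..?m}" "i \<noteq> j" for i j
    using that inj_onD[OF bp(2), of i j] by (auto simp: W_def)
  have "pair_lengths id (bar_pairs ?M) = (\<Sum>i\<in>{1..?m}. pair_lengths id (W i))"
    unfolding pairs pair_lengths_def
    by (rule image_mset_set_UN_disjoint) (use finY disj in \<open>auto simp: W_def\<close>)
  also have "\<dots> = bar_lengths \<mu>"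
    unfolding bar_lengths_def
  proof (rule sum.cong[OF refl])
    fix i assume i: "i \<in> {1..?m}"
    define J where "J = {i<..?m}"
    define E where "E = (\<lambda>j. ?a i - ?a j) ` J"
    have J: "?a j < ?a i" "0 < ?a j" "j \<in> {1..?m}" if "j \<in> J" for j
      using that i bp(3)[of i j] bp(4)[of j] by (auto simp: J_def)
    have inj: "inj_on ?a J" by (rule inj_on_subset[OF bp(2)]) (use i in \<open>auto simp: J_def\<close>)
    have E: "{# ?a i - ?a j. j \<in># mset_set J #} = mset_set E"
      unfolding E_def
      by (rule image_mset_mset_set, rule inj_onI) (use J inj_onD[OF inj] in \<open>metis diff_diff_cancel less_imp_le\<close>)
    have mem: "a \<in> set \<mu> \<and> a < ?a i \<longleftrightarrow> a \<in> ?a ` J" for a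
      unfolding bp(1) using bp(3)[of i] i by (auto simp: J_def image_iff)
    define Y1 where "Y1 = {y \<in> Y i. 0 \<le> y}"
    define Y2 where "Y2 = {y \<in> Y i. y < 0}"
    have Yi: "Y i = Y1 \<union> Y2" "Y1 \<inter> Y2 = {}" by (auto simp: Y1_def Y2_def)
    have fY: "finite Y1" "finite Y2" using finY by (auto simp: Y1_def Y2_def)
    let ?g = "\<lambda>y. nat \<bar>int (?a i) - y\<bar>"
    have W: "pair_lengths id (W i) = image_mset ?g (mset_set (Y i))"
      unfolding pair_lengths_def W_def
      by (subst image_mset_mset_set[symmetric]) (auto simp: inj_on_def multiset.map_comp comp_def)
    have injg: "inj_on ?g (Y i)" by (auto simp: inj_on_def Y_def)
    have "?g ` Y1 = {1..?a i} - E"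
    proof (intro set_eqI iffI)
      fix n assume "n \<in> ?g ` Y1"
      then obtain y where y: "n = ?g y" "y \<notin> ?M" "0 \<le> y" "y < int (?a i)" by (auto simp: Y1_def Y_def)
      have "n \<notin> E"
      proof
        assume "n \<in> E"
        then obtain j where j: "j \<in> J" "n = ?a i - ?a j" by (auto simp: E_def)
        then have "y = int (?a j)" using y J[OF j(1)] by auto
        then show False using y(2) J[OF j(1)] bp(1) by (auto simp: bar_maya_def)
      qed
      then show "n \<in> {1..?a i} - E" using y by auto
    next
      fix n assume n: "n \<in> {1..?a i} - E"
      have "int (?a i - n) \<notin> ?M"
      proof
        assume "int (?a i - n) \<in> ?M"
        then have "?a i - n \<in> set \<mu>" "?a i - n < ?a i" using n by (auto simp: bar_maya_def)
        then have "?a i - n \<in> ?a ` J" using mem by blast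
        then obtain j where j: "j \<in> J" "?a i - n = ?a j" by blast
        then have "n = ?a i - ?a j" using n by auto
        then show False using n j by (auto simp: E_def)
      qed
      then have "int (?a i - n) \<in> Y1" using n by (auto simp: Y1_def Y_def)
      moreover have "n = ?g (int (?a i - n))" using n by auto
      ultimately show "n \<in> ?g ` Y1" by (rule image_eqI[rotated])
    qed
    moreover have "image_mset ?g (mset_set Y1) = mset_set (?g ` Y1)"
      by (rule image_mset_mset_set, rule inj_on_subset[OF injg]) (auto simp: Y1_def)
    ultimately have Y1: "image_mset ?g (mset_set Y1) = mset_set ({1..?a i} - E)" by simp
    have "Y2 = (\<lambda>j. - int (?a j)) ` J"
    proof (intro set_eqI iffI)
      fix y assume "y \<in> Y2"
      then have "nat (- y) \<in> set \<mu>" "nat (- y) < ?a i" "y < 0" by (auto simp: Y2_def Y_def bar_maya_def)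
      then have "nat (- y) \<in> ?a ` J" using mem by blast
      then obtain j where "j \<in> J" "nat (- y) = ?a j" by blast
      then show "y \<in> (\<lambda>j. - int (?a j)) ` J" using \<open>y < 0\<close> by (intro image_eqI[of _ _ j]) auto
    next
      fix y assume "y \<in> (\<lambda>j. - int (?a j)) ` J"
      then obtain j where "j \<in> J" "y = - int (?a j)" by blast
      then show "y \<in> Y2" using J[of j] bp(1) by (auto simp: Y2_def Y_def bar_maya_def)
    qed
    then have "mset_set Y2 = image_mset (\<lambda>j. - int (?a j)) (mset_set J)"
      using inj by (subst image_mset_mset_set) (auto simp: inj_on_def)
    then have Y2: "image_mset ?g (mset_set Y2) = {# ?a i + ?a j. j \<in># mset_set J #}"
      by (simp add: multiset.map_comp comp_def nat_add_distrib)
    \<comment> \<open>The differences lie between 1 and \<open>?a i\<close>, so the multiset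
      difference in \<open>bar_lengths\<close> removes exactly these lengths.\<close>
    have EI: "E \<subseteq> {1..?a i}" using J by (force simp: E_def)
    have "mset_set {1..?a i} = mset_set ({1..?a i} - E) + mset_set E"
    proof -
      have "{1..?a i} = ({1..?a i} - E) \<union> E" using EI by auto
      moreover have "finite E" using EI finite_subset by blast
      ultimately show ?thesis
        using mset_set_Union[of "{1..?a i} - E" E] by auto
    qed
    then have "(mset_set {1..?a i} + {# ?a i + ?a j. j \<in># mset_set J #}) - {# ?a i - ?a j. j \<in># mset_set J #}
      = mset_set ({1..?a i} - E) + {# ?a i + ?a j. j \<in># mset_set J #}"
      unfolding E by simp
    also have "\<dots> = image_mset ?g (mset_set (Y i))"
      unfolding Yi(1) mset_set_Union[OF fY Yi(2)] image_mset_union Y1 Y2 ..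
    finally show "pair_lengths id (W i) = mset_set {1..?a i} + {# ?a i + ?a j. j \<in># mset_set {i<..?m} #}
        - {# ?a i - ?a j. j \<in># mset_set {i<..?m} #}"
      unfolding W J_def by simp
  qed
  finally show ?thesis by simp
qed

section \<open>The bar core and the bar quotient\<close>

lemma finite_bar_pairs_maya: "finite (bar_pairs (bar_maya (set \<mu>)))"
  by (rule finite_subset[OF bar_pairs_subset finite_hook_pairs[OF maya_set_bar_maya]]) simp

text \<open>The gap \<open>y\<close> of the bar decides the kind of removal: \<open>y = 0\<close>
  deletes the part \<open>x\<close>, a positive \<open>y\<close> replaces \<open>x\<close> by
  \<open>y\<close>, a negative \<open>y\<close> deletes both \<open>x\<close> and
  \<open>- y\<close>.\<close>

lemma bar_removal_exists:
  assumes \<mu>: "bar_partition \<mu>" and b: "b \<in># bar_lengths \<mu>"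
  obtains \<mu>' where "bar_removal b \<mu> \<mu>'"
proof -
  let ?A = "set \<mu>"
  have A0: "0 \<notin> ?A" using \<mu> by (simp add: bar_partition_def)
  obtain x y where xy: "(x, y) \<in> bar_pairs (bar_maya ?A)" "b = nat \<bar>x - y\<bar>"
    using b finite_bar_pairs_maya[of \<mu>] unfolding bar_lengths_eq[OF \<mu>] pair_lengths_def by auto
  define a where "a = nat x"
  have a: "x = int a" "a \<in> ?A" "0 < a" "\<bar>y\<bar> < int a" "y \<notin> bar_maya ?A"
    using xy(1) by (auto simp: a_def bar_pairs_def bar_maya_def)
  have b0: "0 < b" using xy(2) a by auto
  consider "y = 0" | "0 < y" | "y < 0" by linarith
  then have "\<exists>B. finite B \<and> 0 \<notin> B \<and> (\<forall>\<mu>'. bar_partition \<mu>' \<and> set \<mu>' = B \<longrightarrow> bar_removal b \<mu> \<mu>')"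
  proof cases
    case 1
    then have "b = a" using xy a by simp
    then show ?thesis using A0 a b0 by (intro exI[of _ "?A - {b}"]) (auto simp: bar_removal_def)
  next
    case 2
    then have "b < a" "a - b = nat y" using xy a by auto
    moreover have "nat y \<notin> ?A" using 2 a by (auto simp: bar_maya_def)
    ultimately show ?thesis using A0 a b0 
      by (intro exI[of _ "insert (a - b) (?A - {a})"]) (auto simp: bar_removal_def)
  next
    case 3
    define a' where "a' = nat (- y)"
    have "a' \<in> ?A" "a \<noteq> a'" "b = a + a'" using 3 a xy by (auto simp: a'_def bar_maya_def)
    then show ?thesis using A0 a b0 \<open>a' \<in> ?A\<close> \<open>a \<noteq> a'\<close> \<open>b = a + a'\<close>
      by (intro exI[of _ "?A - {a, a'}"]) (auto simp: bar_removal_def)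
  qed
  then show ?thesis using that bar_partition_exists by metis
qed

text \<open>In each kind of removal the changes of charge cancel: \<open>d\<close> dividing
  \<open>b\<close> makes \<open>b\<close> congruent to \<open>- b\<close>, \<open>a - b\<close>
  congruent to \<open>a\<close>, or \<open>a'\<close> congruent to \<open>- a\<close>. The sum of
  the parts is the measure for termination.\<close>

lemma bar_removal_step:
  assumes \<mu>: "bar_partition \<mu>" and rem: "bar_removal b \<mu> \<mu>'" and db: "d dvd b"
  shows "bar_partition \<mu>'" and "charge (int d) (bar_maya (set \<mu>')) i = charge (int d) (bar_maya (set \<mu>)) i"
    and "\<Sum>(set \<mu>') < \<Sum>(set \<mu>)"
proof -
  let ?A = "set \<mu>"
  have A0: "0 \<notin> ?A" using \<mu> by (simp add: bar_partition_def)
  have pos: "0 < a" if "a \<in> ?A" for a using A0 that by (cases a) auto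
  have b: "0 < b" "bar_partition \<mu>'" using rem by (auto simp: bar_removal_def)
  then show "bar_partition \<mu>'" by simp
  have dvd: "int d dvd int b" using db by simp
  have sum_remove: "\<Sum>B = a + \<Sum>(B - {a})" if "finite B" "a \<in> B" for a and B :: "nat set"
    using that by (rule sum.remove)
  consider "b \<in> ?A" "set \<mu>' = ?A - {b}"
    | a where "a \<in> ?A" "b < a" "a - b \<notin> ?A" "set \<mu>' = insert (a - b) (?A - {a})"
    | a a' where "a \<in> ?A" "a' \<in> ?A" "a \<noteq> a'" "b = a + a'" "set \<mu>' = ?A - {a, a'}"
    using rem unfolding bar_removal_def by blast
  then have "charge (int d) (bar_maya (set \<mu>')) i = charge (int d) (bar_maya ?A) i \<and> \<Sum>(set \<mu>') < \<Sum>?A"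
  proof cases
    case 1
    have "int b mod int d = - int b mod int d" using dvd by (simp add: mod_eq_dvd_iff)
    then show ?thesis
      using charge_bar_remove[OF _ b(1) 1(1), of "int d" i] sum_remove[OF _ 1(1)] b(1) 1(2) by simp
  next
    case 2
    have m: "int (a - b) mod int d = int a mod int d" "- int (a - b) mod int d = - int a mod int d"
      using dvd 2 by (simp_all add: mod_eq_dvd_iff of_nat_diff)
    have "charge (int d) (bar_maya (set \<mu>')) i = charge (int d) (bar_maya ?A) i"
      unfolding 2(4) using charge_bar_remove[OF _ pos[OF 2(1)] 2(1), of "int d" i] 2
        charge_bar_insert[of "?A - {a}" "a - b" "int d" i]
      unfolding m by simp
    moreover have "\<Sum>(set \<mu>') < \<Sum>?A"
      unfolding 2(4) using sum_remove[OF _ 2(1)] 2 b(1) by simp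
    ultimately show ?thesis by simp
  next
    case 3
    have "int a' - (- int a) = int b" "- int a' - int a = - int b" using 3(4) by simp_all
    then have m: "int a' mod int d = - int a mod int d" "- int a' mod int d = int a mod int d"
      using dvd unfolding mod_eq_dvd_iff by (simp_all only: dvd_minus_iff)
    have a': "a' \<in> ?A - {a}" using 3 by simp
    have set': "set \<mu>' = ?A - {a} - {a'}" unfolding 3(5) by auto
    have "charge (int d) (bar_maya (set \<mu>')) i = charge (int d) (bar_maya ?A) i"
      unfolding set' using charge_bar_remove[OF _ pos[OF 3(1)] 3(1), of "int d" i]
        charge_bar_remove[OF _ pos[OF 3(2)] a', of "int d" i]
      unfolding m by simp
    moreover have "\<Sum>(set \<mu>') < \<Sum>?A"
      unfolding set' using sum_remove[OF _ 3(1)] sum_remove[OF _ a'] pos[OF 3(1)] by simp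
    ultimately show ?thesis by simp
  qed
  then show "charge (int d) (bar_maya (set \<mu>')) i = charge (int d) (bar_maya (set \<mu>)) i"
    and "\<Sum>(set \<mu>') < \<Sum>(set \<mu>)" by auto
qed

text \<open>Oddness of \<open>d\<close> enters here: a diagonal hook \<open>(x, -x)\<close> of length \<open>2x\<close> divisible by \<open>d\<close> is not a
  bar, but then \<open>d\<close> divides the length \<open>x\<close> of the bar \<open>(x, 0)\<close>.\<close>

lemma bar_core_flush:
  assumes d: "odd d" "0 < d" and \<mu>: "bar_partition \<mu>" and F: "\<forall>b \<in># bar_lengths \<mu>. \<not> d dvd b"
  shows "normalized (int d) (bar_maya (set \<mu>)) = {..<0}"
proof (rule flush_normalized)
  let ?M = "bar_maya (set \<mu>)"
  show "maya_set ?M" by (rule maya_set_bar_maya) simp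
  show "0 < int d" using d by simp
  have bar: "\<not> int d dvd x - y" if "(x, y) \<in> bar_pairs ?M" for x y
  proof -
    have "nat \<bar>x - y\<bar> \<in># bar_lengths \<mu>"
      unfolding bar_lengths_eq[OF \<mu>] pair_lengths_def
      using that finite_bar_pairs_maya[of \<mu>] by (force simp: image_iff)
    then have "\<not> d dvd nat \<bar>x - y\<bar>" using F by blast
    then show ?thesis by simp
  qed
  have sym: "0 \<notin> ?M" "\<And>x. x \<noteq> 0 \<Longrightarrow> x \<in> ?M \<longleftrightarrow> - x \<notin> ?M"
    using bar_symmetric_bar_maya[of "set \<mu>"] unfolding bar_symmetric_def by blast+
  fix x y assume a: "x \<in> ?M" "y \<notin> ?M" "y < x"
  then have x0: "x \<noteq> 0" using sym(1) by auto
  consider "\<bar>y\<bar> < x" | "y = - x" | "\<bar>x\<bar> < - y" using a by linarith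
  then show "\<not> int d dvd x - y"
  proof cases
    case 1
    then show ?thesis using bar a by (auto simp: bar_pairs_def)
  next
    case 2
    then have "(x, 0) \<in> bar_pairs ?M" using a sym(1) by (auto simp: bar_pairs_def)
    then have "\<not> int d dvd x" using bar by fastforce
    moreover have "coprime (int d) 2" using d by simp
    ultimately show ?thesis using 2 by (simp add: coprime_dvd_mult_right_iff flip: mult_2)
  next
    case 3
    then have "(- y, - x) \<in> bar_pairs ?M" using a sym(2)[of x] sym(2)[of y] x0 by (auto simp: bar_pairs_def)
    then show ?thesis using bar by fastforce
  qed
qed

text \<open>Removing bars of length divisible by \<open>d\<close> keeps the charges, and a terminal
  diagram normalizes to the negative integers. Undoing the normalization with the charges of
  \<open>lam\<close> yields the same image for every terminal state, so the description in
  \<open>bar_core\<close> is unique.\<close>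

lemma bar_core_maya:
  assumes d: "odd d" "0 < d" and lam: "bar_partition lam"
  shows "bar_partition (bar_core d lam)"
    and "bar_maya (set (bar_core d lam)) = (\<lambda>x. x + int d * charge (int d) (bar_maya (set lam)) x) ` {..<0}"
proof -
  define R where "R = (\<lambda>\<mu>1 \<mu>2. \<exists>b. d dvd b \<and> bar_removal b \<mu>1 \<mu>2)"
  define F where "F \<kappa> \<longleftrightarrow> (\<forall>b \<in># bar_lengths \<kappa>. \<not> d dvd b)" for \<kappa>
  let ?ch = "\<lambda>\<mu>. charge (int d) (bar_maya (set \<mu>))"
  have core: "bar_core d lam = (THE \<kappa>. R\<^sup>*\<^sup>* lam \<kappa> \<and> F \<kappa>)" unfolding bar_core_def R_def F_def by simp
  have step: "bar_partition y \<and> ?ch y = ?ch x \<and> \<Sum>(set y) < \<Sum>(set x)"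
    if Rxy: "R x y" and x: "bar_partition x" for x y
  proof -
    obtain b where "d dvd b" "bar_removal b x y" using Rxy by (auto simp: R_def)
    then show ?thesis using bar_removal_step[OF x] by blast
  qed
  have reach: "bar_partition y \<and> ?ch y = ?ch lam" if "R\<^sup>*\<^sup>* lam y" for y
    using that by (induction rule: rtranclp_induct) (use lam step in auto)
  have image: "bar_maya (set y) = (\<lambda>x. x + int d * ?ch lam x) ` {..<0}" if "R\<^sup>*\<^sup>* lam y" "F y" for y
    using image_shift_normalized[of "int d" "bar_maya (set y)"] reach[OF that(1)]
      bar_core_flush[OF d, of y] that(2) unfolding F_def by simp
  have "\<exists>y. R\<^sup>*\<^sup>* lam y \<and> F y"
  proof (rule rtranclp_final_exists[of bar_partition F R "\<lambda>\<mu>. \<Sum>(set \<mu>)"])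
    show "\<exists>y. R x y \<and> bar_partition y \<and> \<Sum>(set y) < \<Sum>(set x)" if px: "bar_partition x" and nF: "\<not> F x" for x
    proof -
      obtain b where b: "b \<in># bar_lengths x" "d dvd b" using nF by (auto simp: F_def)
      obtain y where "bar_removal b x y" using bar_removal_exists[OF px b(1)] by blast
      then have "R x y" using b by (auto simp: R_def)
      then show ?thesis using step px by blast
    qed
  qed (rule lam)
  then obtain \<kappa> where \<kappa>: "R\<^sup>*\<^sup>* lam \<kappa>" "F \<kappa>" by blast
  have eq: "bar_core d lam = \<kappa>" unfolding core
  proof (rule the_equality)
    fix y assume y: "R\<^sup>*\<^sup>* lam y \<and> F y"
    then have "bar_maya (set y) = bar_maya (set \<kappa>)" by (simp only: image[of y] image[OF \<kappa>])
    then show "y = \<kappa>" using reach[of y] reach[OF \<kappa>(1)] y by (intro bar_partition_maya_inject) blast+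
  qed (use \<kappa> in simp)
  show "bar_partition (bar_core d lam)" unfolding eq using reach[OF \<kappa>(1)] by blast
  show "bar_maya (set (bar_core d lam)) = (\<lambda>x. x + int d * ?ch lam x) ` {..<0}"
    unfolding eq by (rule image[OF \<kappa>])
qed

text \<open>Negation maps the beads at or above 0 in one class onto the gaps below 0 in the opposite
  class, since 0 is no bead. This makes the shift by the charges of \<open>lam\<close> an odd
  function.\<close>

lemma charge_uminus:
  assumes "bar_symmetric S" shows "charge d S (- i) = - charge d S i"
proof -
  have sym: "0 \<notin> S" "\<And>x. x \<noteq> 0 \<Longrightarrow> x \<in> S \<longleftrightarrow> - x \<notin> S"
    using assms unfolding bar_symmetric_def by blast+
  have m: "- x mod d = j mod d \<longleftrightarrow> x mod d = - j mod d" for x j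
    by (metis mod_minus_cong minus_minus)
  have "uminus ` {x \<in> S. 0 \<le> x \<and> x mod d = - j mod d} = {x. x \<notin> S \<and> x < 0 \<and> x mod d = j mod d}" for j
  proof (intro set_eqI iffI)
    fix x assume "x \<in> uminus ` {x \<in> S. 0 \<le> x \<and> x mod d = - j mod d}"
    then obtain u where u: "x = - u" "u \<in> S" "0 \<le> u" "u mod d = - j mod d" by blast
    then have "u \<noteq> 0" using sym(1) by auto
    then show "x \<in> {x. x \<notin> S \<and> x < 0 \<and> x mod d = j mod d}" using u sym(2)[of u] m[of u j] by auto
  next
    fix x assume x: "x \<in> {x. x \<notin> S \<and> x < 0 \<and> x mod d = j mod d}"
    then have "- x \<in> {x \<in> S. 0 \<le> x \<and> x mod d = - j mod d}" using sym(2)[of x] m[of "- x" j] by auto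
    then show "x \<in> uminus ` {x \<in> S. 0 \<le> x \<and> x mod d = - j mod d}" by (rule image_eqI[rotated]) simp
  qed
  then have c: "card {x \<in> S. 0 \<le> x \<and> x mod d = - j mod d} = card {x. x \<notin> S \<and> x < 0 \<and> x mod d = j mod d}" for j
    by (metis (no_types, lifting) card_image inj_uminus)
  show ?thesis using c[of i] c[of "- i"] unfolding charge_def by simp
qed

lemma maya_set_normalized:
  assumes "maya_set S" "0 < d" shows "maya_set (normalized d S)"
proof -
  \<comment> \<open>With the negated charge as \<open>t\<close>, the inverse map \<chi> is the shift
    in the definition of \<open>normalized\<close>.\<close>
  interpret runner_shift d "\<lambda>x. - charge d S x"
  proof
    show "- charge d S x = - charge d S y" if "x mod d = y mod d" for x y
      using charge_cong[OF that, of S] by simp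
  qed (rule assms(2))
  have "\<phi> ` S = normalized d S"
    by (rule set_eqI) (simp add: \<phi>_image normalized_def \<chi>_def)
  then show ?thesis using maya_set_\<phi>_image[OF assms(1)] by simp
qed

text \<open>The shift by \<open>d\<close> times the charge is odd and vanishes only at 0, so it
  respects the symmetry.\<close>

lemma bar_symmetric_normalized:
  assumes "bar_symmetric S" shows "bar_symmetric (normalized d S)"
proof -
  have sym: "0 \<notin> S" "\<And>x. x \<noteq> 0 \<Longrightarrow> x \<in> S \<longleftrightarrow> - x \<notin> S"
    using assms unfolding bar_symmetric_def by blast+
  have c0: "charge d S 0 = 0" using charge_uminus[OF assms, of d 0] by simp
  show ?thesis unfolding bar_symmetric_def
  proof (intro conjI allI impI)
    show "0 \<notin> normalized d S" using sym(1) c0 by (simp add: normalized_def)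
    fix x :: int assume x: "x \<noteq> 0"
    have "x + d * charge d S x \<noteq> 0"
    proof
      assume "x + d * charge d S x = 0"
      then have "0 = charge d S x" using charge_add_mult(1)[of d S x "charge d S x"] c0 by simp
      then show False using \<open>x + d * charge d S x = 0\<close> x by simp
    qed
    from sym(2)[OF this] show "x \<in> normalized d S \<longleftrightarrow> - x \<notin> normalized d S"
      by (simp add: normalized_def charge_uminus[OF assms])
  qed
qed

lemma bar_maya_exists:
  assumes "maya_set S" "bar_symmetric S"
  obtains \<mu> where "bar_partition \<mu>" "bar_maya (set \<mu>) = S"
proof -
  define A where "A = nat ` {x \<in> S. 0 \<le> x \<and> 0 < x}"
  have "finite A" unfolding A_def by (rule finite_imageI[OF finite_maya_nonneg[OF assms(1)]])
  moreover have "0 \<notin> A" by (auto simp: A_def)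
  ultimately obtain \<mu> where \<mu>: "bar_partition \<mu>" "set \<mu> = A" by (rule bar_partition_exists)
  have A: "nat x \<in> A \<longleftrightarrow> x \<in> S" if "0 < x" for x
  proof -
    have "nat x \<in> A \<longleftrightarrow> (\<exists>u\<in>S. 0 < u \<and> nat x = nat u)" by (auto simp: A_def)
    also have "\<dots> \<longleftrightarrow> x \<in> S" using that by (auto simp: eq_nat_nat_iff)
    finally show ?thesis .
  qed
  have "x \<in> bar_maya A \<longleftrightarrow> x \<in> S" for x
  proof -
    have sym: "0 \<notin> S" "x \<noteq> 0 \<Longrightarrow> x \<in> S \<longleftrightarrow> - x \<notin> S"
      using assms(2) unfolding bar_symmetric_def by blast+
    consider "0 < x" | "x = 0" | "x < 0" by linarith
    then show ?thesis by cases (use A[of x] A[of "- x"] sym in \<open>auto simp: bar_maya_def\<close>)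
  qed
  then show ?thesis using that \<mu> by blast
qed

text \<open>Empty core means that all charges vanish, and such a diagram equals its own
  normalization; equal quotients mean equal normalizations. The only candidate is thus the
  normalized diagram of \<open>lam\<close>, which by symmetry belongs to a bar partition.\<close>

lemma bar_quotient_maya:
  assumes d: "0 < d" and lam: "bar_partition lam"
  shows "bar_partition (bar_quotient d lam)"
    and "bar_maya (set (bar_quotient d lam)) = normalized (int d) (bar_maya (set lam))"
proof -
  let ?N = "normalized (int d) (bar_maya (set lam))"
  have d': "0 < int d" using d by simp
  have ms: "maya_set (bar_maya (set \<mu>))" for \<mu> by (rule maya_set_bar_maya) simp
  have srt: "sorted_wrt (\<ge>) (doubled \<mu>)" if "bar_partition \<mu>" for \<mu>
    using doubled_lower_rows(1)[OF that] by (simp add: is_partition_def)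
  have char: "hook_core d (doubled \<mu>) = [] \<and> quotient d (doubled \<mu>) = quotient d (doubled lam)
    \<longleftrightarrow> bar_maya (set \<mu>) = ?N" if \<mu>: "bar_partition \<mu>" for \<mu>
  proof -
    have 0: "normalized (int d) T = T" if "\<forall>i. charge (int d) T i = 0" for T
      using that by (simp add: normalized_def)
    show ?thesis
      unfolding hook_core_eq_Nil_iff[OF d doubled_lower_rows(1)[OF \<mu>]]
        quotient_eq_iff[OF d srt[OF \<mu>] srt[OF lam]] maya_doubled[OF \<mu>] maya_doubled[OF lam]
      using 0 charge_normalized[OF ms d', of lam] by metis
  qed
  obtain q where q: "bar_partition q" "bar_maya (set q) = ?N"
    using bar_maya_exists[OF maya_set_normalized[OF ms d'] bar_symmetric_normalized[OF bar_symmetric_bar_maya]]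
    by blast
  have "bar_quotient d lam = q"
    unfolding bar_quotient_def
  proof (rule the_equality)
    show "bar_partition q \<and> hook_core d (doubled q) = [] \<and> quotient d (doubled q) = quotient d (doubled lam)"
      using q char by blast
    fix \<mu> assume "bar_partition \<mu> \<and> hook_core d (doubled \<mu>) = [] \<and> quotient d (doubled \<mu>) = quotient d (doubled lam)"
    then have "bar_partition \<mu>" "bar_maya (set \<mu>) = ?N" using char by blast+
    then show "\<mu> = q" using q bar_partition_maya_inject by auto
  qed
  then show "bar_partition (bar_quotient d lam)" "bar_maya (set (bar_quotient d lam)) = ?N" using q by auto
qed

section \<open>Modified bar lengths\<close>

text \<open>The hand residue is that of the bead and, by the shift of one in the foot convention,
  \<open>j\<close> is that of the gap. In the difference of bead counts the constant
  \<open>K\<close> cancels.\<close>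

lemma modified_length_eq:
  assumes d: "0 < d" and lam: "bar_partition lam"
  shows "modified_length d lam q (r, c) =
    int (hook_length (doubled q) (r, c)) + int d * charge (int d) (bar_maya (set lam)) (bead (doubled q) r)
      - int d * charge (int d) (bar_maya (set lam)) (gap (doubled q) c)"
proof -
  let ?t = "charge (int d) (bar_maya (set lam))"
  have d': "0 < int d" using d by simp
  have srt: "sorted_wrt (\<ge>) (doubled lam)"
    using doubled_lower_rows(1)[OF lam] by (simp add: is_partition_def)
  obtain K where K: "\<And>i. i < d \<Longrightarrow> int (card (runner d (doubled lam) i)) = int K + ?t (int i)"
    using runner_maya[OF d srt] unfolding maya_doubled[OF lam] by metis
  have run: "int (card (runner d (doubled lam) (nat (x mod int d)))) = int K + ?t x" for x
  proof -
    have "nat (x mod int d) < d" "int (nat (x mod int d)) = x mod int d" using d' by (auto simp: nat_less_iff)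
    moreover have "?t (x mod int d) = ?t x" by (rule charge_cong) simp
    ultimately show ?thesis using K by metis
  qed
  have hand: "residue d (hand_node (doubled q) (r, c)) = nat (bead (doubled q) r mod int d)"
    by (simp add: residue_def hand_node_def bead_def)
  have "int (residue d (foot_node (doubled q) (r, c))) = (int c - int (col_len (doubled q) c)) mod int d"
    using d' by (simp add: residue_def foot_node_def)
  then have foot: "(int (residue d (foot_node (doubled q) (r, c))) - 1) mod int d = gap (doubled q) c mod int d"
    by (simp add: gap_def mod_diff_left_eq algebra_simps)
  show ?thesis
    unfolding modified_length_def Let_def hand foot run by (simp add: algebra_simps)
qed

lemma finite_bar_hooks: "finite (part_hooks q \<union> other_bar_hooks q)"
proof -
  have "part_hooks q \<subseteq> {1..length q} \<times> {length q + 1}"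
    "other_bar_hooks q \<subseteq> (SIGMA r:{1..length q}. {..r + row_len q r})"
    by (auto simp: part_hooks_def other_bar_hooks_def)
  then show ?thesis by (meson finite_SigmaI finite_Un finite_atLeastAtMost finite_atMost finite_subset finite.emptyI finite.insertI)
qed

text \<open>In the first \<open>length q\<close> rows, the nodes with \<open>r < c\<close> are those
  whose gap exceeds minus the bead, so they correspond to the bars.\<close>

lemma modified_bar_lengths_eq:
  assumes d: "0 < d" and lam: "bar_partition lam" and q: "bar_partition q"
  shows "modified_bar_lengths d lam q =
    pair_lengths (\<lambda>x. x + int d * charge (int d) (bar_maya (set lam)) x) (bar_pairs (bar_maya (set q)))"
proof -
  let ?D = "doubled q" and ?M = "bar_maya (set q)" and ?m = "length q"
  let ?\<phi> = "\<lambda>x. x + int d * charge (int d) (bar_maya (set lam)) x"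
  define h where "h = (\<lambda>(r, c). (bead ?D r, gap ?D c))"
  define Z where "Z = part_hooks q \<union> other_bar_hooks q"
  note b = doubled_beads[OF q] and bp = bar_partition_set[OF q]
  have srt: "sorted_wrt (\<ge>) ?D" using doubled_lower_rows(1)[OF q] by (simp add: is_partition_def)
  \<comment> \<open>\<open>part_hooks\<close> supplies the column missing in
    \<open>other_bar_hooks\<close>; its nodes satisfy the same bounds since
    \<open>length q < r + row_len q r\<close>.\<close>
  have Z: "(r, c) \<in> Z \<longleftrightarrow> 1 \<le> r \<and> r \<le> ?m \<and> r < c \<and> c \<le> r + row_len q r" for r c
    using bar_partition_row_len(2)[OF q, of r r]
    by (auto simp: Z_def part_hooks_def other_bar_hooks_def)
  have yd: "(r, c) \<in> young_diagram ?D" if "(r, c) \<in> Z" for r c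
    using that doubled_row_col(1)[OF q, of r] by (auto simp: Z young_diagram_iff)
  have "inj_on h Z"
  proof (rule inj_onI)
    fix z w assume a: "z \<in> Z" "w \<in> Z" "h z = h w"
    obtain r c r' c' where zw: "z = (r, c)" "w = (r', c')" by (cases z, cases w)
    then show "z = w"
      using a bead_eq_iff[OF srt, of r r'] gap_eq_iff[OF srt, of c c'] by (auto simp: h_def Z)
  qed
  moreover have "h ` Z = bar_pairs ?M"
  proof (intro set_eqI iffI)
    fix p assume "p \<in> h ` Z"
    then obtain r c where rc: "(r, c) \<in> Z" "p = (bead ?D r, gap ?D c)" by (auto simp: h_def)
    then have r: "1 \<le> r" "r \<le> ?m" "r < c" by (auto simp: Z)
    have "gap ?D c < bead ?D r" using gap_less_bead_iff(1)[OF srt, of r c] yd[OF rc(1)] r by simp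
    moreover have "- bead ?D r < gap ?D c"
      using b(1)[OF r(1,2)] b(3)[of c] b(4)[of c] bp(3)[of r c] bp(4)[OF r(1,2)] r by (cases "c \<le> ?m") auto
    moreover have "bead ?D r \<in> ?M" unfolding maya_doubled[OF q, symmetric] using r by (simp add: maya_def)
    moreover have "gap ?D c \<notin> ?M"
      unfolding maya_doubled[OF q, symmetric] using Compl_maya[OF srt] r by auto
    ultimately show "p \<in> bar_pairs ?M" using rc by (auto simp: bar_pairs_def)
  next
    fix p assume "p \<in> bar_pairs ?M"
    then obtain x y where p: "p = (x, y)" "x \<in> maya ?D" "y \<notin> maya ?D" "\<bar>y\<bar> < x"
      unfolding maya_doubled[OF q, symmetric] by (auto simp: bar_pairs_def)
    obtain r where r: "1 \<le> r" "x = bead ?D r" using p(2) by (auto simp: maya_def)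
    obtain c where c: "1 \<le> c" "y = gap ?D c" using p(3) Compl_maya[OF srt] by blast
    have rm: "r \<le> ?m" using b(2)[of r] r p(4) by (cases "r \<le> ?m") auto
    have "y < x" using p(4) by linarith
    then have "(r, c) \<in> young_diagram ?D" using gap_less_bead_iff(1)[OF srt r(1) c(1)] r c by simp
    then have "c \<le> r + row_len q r" using doubled_row_col(1)[OF q r(1) rm] by (simp add: young_diagram_iff)
    moreover have "r < c"
      using b(1)[OF r(1) rm] b(3)[of c] bp(3)[of r c] r rm c p by (cases "c \<le> ?m") auto
    ultimately have "(r, c) \<in> Z" using r rm by (simp add: Z)
    moreover have "p = h (r, c)" using p r c by (simp add: h_def)
    ultimately show "p \<in> h ` Z" by blast
  qed
  ultimately have pairs: "mset_set (bar_pairs ?M) = image_mset h (mset_set Z)"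
    using image_mset_mset_set by metis
  have "modified_length d lam q z = (case h z of (x, y) \<Rightarrow> ?\<phi> x - ?\<phi> y)" if "z \<in> Z" for z
  proof -
    obtain r c where z: "z = (r, c)" by (cases z)
    have "modified_length d lam q (r, c) = ?\<phi> (bead ?D r) - ?\<phi> (gap ?D c)"
      unfolding modified_length_eq[OF d lam] int_hook_length[OF srt yd[OF that[unfolded z]]] by simp
    then show ?thesis by (simp add: h_def z)
  qed
  moreover have "finite Z" unfolding Z_def by (rule finite_bar_hooks)
  ultimately show ?thesis
    unfolding modified_bar_lengths_def Z_def[symmetric] pair_lengths_def pairs multiset.map_comp
    by (intro image_mset_cong) (simp add: case_prod_unfold)
qed

text \<open>The gap of column \<open>length q + 1\<close> is 0, and the charge of its class vanishes
  because it equals its own negative.\<close>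

lemma modified_parts_eq:
  assumes d: "0 < d" and lam: "bar_partition lam" and q: "bar_partition q"
  shows "modified_parts d lam q =
    {# nat \<bar>int a + int d * charge (int d) (bar_maya (set lam)) (int a)\<bar>. a \<in># mset_set (set q) #}"
proof -
  let ?D = "doubled q" and ?m = "length q"
  let ?t = "charge (int d) (bar_maya (set lam))"
  note b = doubled_beads[OF q] and bp = bar_partition_set[OF q]
  have srt: "sorted_wrt (\<ge>) ?D" using doubled_lower_rows(1)[OF q] by (simp add: is_partition_def)
  have "part_hooks q = (\<lambda>r. (r, ?m + 1)) ` {1..?m}" by (auto simp: part_hooks_def)
  then have P: "mset_set (part_hooks q) = image_mset (\<lambda>r. (r, ?m + 1)) (mset_set {1..?m})"
    by (simp add: image_mset_mset_set inj_on_def)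
  have S: "mset_set (set q) = image_mset (row_len q) (mset_set {1..?m})"
    unfolding bp(1) using image_mset_mset_set[OF bp(2)] by simp
  have "?t 0 = 0" using charge_uminus[OF bar_symmetric_bar_maya, of "int d" "set lam" 0] by simp
  moreover have "int (hook_length ?D (r, ?m + 1)) = int (row_len q r)" if "1 \<le> r" "r \<le> ?m" for r
  proof -
    have "(r, ?m + 1) \<in> young_diagram ?D"
      using gap_less_bead_iff(1)[OF srt that(1), of "?m + 1"] b(1)[OF that] b(5) bp(4)[OF that] by simp
    then show ?thesis using int_hook_length[OF srt] b(1)[OF that] b(5) by simp
  qed
  ultimately have "modified_length d lam q (r, ?m + 1) = int (row_len q r) + int d * ?t (int (row_len q r))"
    if "1 \<le> r" "r \<le> ?m" for r
    unfolding modified_length_eq[OF d lam] b(5) b(1)[OF that] using that by simp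
  then show ?thesis
    unfolding modified_parts_def P S multiset.map_comp by (intro image_mset_cong) simp
qed

lemma positive_bar_maya:
  "0 \<notin> A \<Longrightarrow> {x \<in> bar_maya A. 0 < x} = int ` A"
proof (intro set_eqI iffI)
  fix x assume "x \<in> {x \<in> bar_maya A. 0 < x}"
  then have "nat x \<in> A" "x = int (nat x)" by (auto simp: bar_maya_def)
  then show "x \<in> int ` A" by (rule image_eqI[rotated])
next
  fix x assume "0 \<notin> A" "x \<in> int ` A"
  then obtain a where "x = int a" "a \<in> A" "a \<noteq> 0" by auto
  then show "x \<in> {x \<in> bar_maya A. 0 < x}" by (auto simp: bar_maya_def)
qed

lemma bar_pair_lengths_fold:
  assumes "finite A" "0 \<notin> A" and odd: "\<And>x. \<phi> (- x) = - \<phi> x"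
  defines "P \<equiv> {# nat \<bar>\<phi> (int a)\<bar>. a \<in># mset_set A #}"
  shows "pair_lengths \<phi> (hook_pairs (bar_maya A)) + P =
    pair_lengths \<phi> (bar_pairs (bar_maya A)) + pair_lengths \<phi> (bar_pairs (bar_maya A)) + {# 2 * a. a \<in># P #}"
proof -
  have "mset_set {x \<in> bar_maya A. 0 < x} = image_mset int (mset_set A)"
    unfolding positive_bar_maya[OF assms(2)] by (simp add: image_mset_mset_set)
  then show ?thesis
    using pair_lengths_fold[of "bar_maya A" \<phi>, OF maya_set_bar_maya[OF assms(1)] bar_symmetric_bar_maya odd]
    by (simp add: P_def multiset.map_comp comp_def)
qed

theorem theorem4p1:
  fixes d :: nat and lam c q :: "nat list"
  assumes "d \<ge> 3" and "odd d" and "bar_partition lam"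
    and "c = bar_core d lam" and "q = bar_quotient d lam"
  shows "bar_lengths lam = bar_lengths c + tilde_bar_lengths d lam c q"
proof -
  have d_pos: "0 < d" using assms(1) by simp
  define M where "M = bar_maya (set lam)"
  define t where "t = charge (int d) M"
  interpret runner_shift "int d" t
  proof
    show "t x = t y" if "x mod int d = y mod int d" for x y
      unfolding t_def by (rule charge_cong[OF that])
  qed (use d_pos in simp)
  have \<phi>: "\<phi> = (\<lambda>x. x + int d * charge (int d) (bar_maya (set lam)) x)"
    by (rule ext, subst \<phi>_def) (simp only: t_def M_def)
  have odd: "\<phi> (- x) = - \<phi> x" for x
    unfolding \<phi> charge_uminus[OF bar_symmetric_bar_maya] by simp
  have \<phi>0: "\<phi> 0 = 0" using odd[of 0] by simp
  have lam: "bar_partition lam" by fact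
  have c: "bar_partition c" "bar_maya (set c) = \<phi> ` {..<0}"
    using bar_core_maya[OF assms(2) d_pos lam] assms(4) \<phi> by auto
  have q: "bar_partition q" "bar_maya (set q) = normalized (int d) M"
    using bar_quotient_maya[OF d_pos lam] assms(5) M_def by auto
  have M: "bar_maya (set lam) = \<phi> ` bar_maya (set q)"
    unfolding q(2) \<phi> M_def image_shift_normalized ..
  have zero: "0 \<notin> set lam" "0 \<notin> set c" "0 \<notin> set q" using lam c q by (auto simp: bar_partition_def)

  define Pq where "Pq = (\<lambda>a. nat \<bar>\<phi> (int a)\<bar>) ` set q"
  \<comment> \<open>As \<phi> is odd and injective, equal absolute values force
    \<open>a = a'\<close> or \<open>a = - a'\<close>, and for natural numbers both give
    \<open>a = a'\<close>. So the modified parts are distinct.\<close>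
  have "inj_on (\<lambda>a. nat \<bar>\<phi> (int a)\<bar>) (set q)"
  proof (rule inj_onI)
    fix a a' assume "nat \<bar>\<phi> (int a)\<bar> = nat \<bar>\<phi> (int a')\<bar>"
    then have "\<phi> (int a) = \<phi> (int a') \<or> \<phi> (int a) = \<phi> (- int a')" unfolding odd by linarith
    then show "a = a'" unfolding \<phi>_inj by auto
  qed
  then have Pq: "{# nat \<bar>\<phi> (int a)\<bar>. a \<in># mset_set (set q) #} = mset_set Pq"
    unfolding Pq_def by (rule image_mset_mset_set)
  have mp: "modified_parts d lam q = mset_set Pq"
    unfolding modified_parts_eq[OF d_pos lam q(1)] Pq[symmetric] \<phi> ..
  \<comment> \<open>For \<open>n > 0\<close> let \<open>u\<close> be its preimage under \<phi>. Then
    \<open>n\<close> is a part of the core iff \<open>u < 0\<close>, a modified part iff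
    \<open>\<bar>u\<bar>\<close> is a part of \<open>q\<close>, and a part of \<open>lam\<close> iff
    \<open>u\<close> is a bead of \<open>q\<close>. For \<open>u < 0\<close>, being a bead means
    that \<open>- u\<close> is not a part, whence the exclusive or.\<close>
  have lam_iff: "n \<in> set lam \<longleftrightarrow> (n \<in> set c) \<noteq> (n \<in> Pq)" for n
  proof (cases "n = 0")
    case True
    have "0 \<notin> Pq"
    proof
      assume "0 \<in> Pq"
      then obtain a where "a \<in> set q" "\<phi> (int a) = \<phi> 0" unfolding Pq_def \<phi>0 by auto
      then show False unfolding \<phi>_inj using zero by simp
    qed
    then show ?thesis using True zero by simp
  next
    case False
    define u where "u = \<chi> (int n)"
    have u: "\<phi> u = int n" by (simp add: u_def)
    then have u0: "u \<noteq> 0" using \<phi>0 False by auto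
    have mem: "n \<in> A \<longleftrightarrow> int n \<in> bar_maya A" for A using False by (auto simp: bar_maya_def)
    have "n \<in> set lam \<longleftrightarrow> u \<in> bar_maya (set q)" unfolding mem M \<phi>_image u_def ..
    moreover have "n \<in> set c \<longleftrightarrow> u < 0" unfolding mem c(2) \<phi>_image u_def by simp
    moreover have "n \<in> Pq \<longleftrightarrow> nat \<bar>u\<bar> \<in> set q"
    proof
      assume "n \<in> Pq"
      then obtain a where a: "a \<in> set q" "n = nat \<bar>\<phi> (int a)\<bar>" by (auto simp: Pq_def)
      then have "\<phi> u = \<phi> (int a) \<or> \<phi> u = \<phi> (- int a)" unfolding odd u by linarith
      then show "nat \<bar>u\<bar> \<in> set q" unfolding \<phi>_inj using a by auto
    next
      assume a: "nat \<bar>u\<bar> \<in> set q"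
      have "\<bar>\<phi> \<bar>u\<bar>\<bar> = int n" using u odd[of u] by (cases "0 \<le> u") auto
      then have "n = nat \<bar>\<phi> (int (nat \<bar>u\<bar>))\<bar>" by simp
      then show "n \<in> Pq" unfolding Pq_def using a by (rule image_eqI)
    qed
    ultimately show ?thesis using u0 by (auto simp: bar_maya_def)
  qed
  define e where "e = parts c \<inter># modified_parts d lam q"
  \<comment> \<open>The three sets of parts are multiplicity-free, so this is the symmetric
    difference with the intersection \<open>e\<close> added back twice.\<close>
  have sym_diff: "parts lam + e + e = parts c + mset_set Pq"
  proof (rule multiset_eqI)
    fix n
    show "count (parts lam + e + e) n = count (parts c + mset_set Pq) n"
      using lam_iff[of n] unfolding e_def mp parts_def by (auto simp: count_mset_set' Pq_def)
  qed
  let ?D = "image_mset (\<lambda>a. 2 * a :: nat)"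
  let ?B = "\<lambda>f A. pair_lengths f (bar_pairs (bar_maya A))"
  have id: "{# nat \<bar>id (int a)\<bar>. a \<in># mset_set A #} = mset_set A" for A by simp
  have fold_lam: "pair_lengths id (hook_pairs (bar_maya (set lam))) + parts lam =
      bar_lengths lam + bar_lengths lam + ?D (parts lam)"
    and fold_c: "pair_lengths id (hook_pairs (bar_maya (set c))) + parts c =
      bar_lengths c + bar_lengths c + ?D (parts c)"
    unfolding bar_lengths_eq[OF lam] bar_lengths_eq[OF c(1)] parts_def
    using bar_pair_lengths_fold[of "set lam" id] bar_pair_lengths_fold[of "set c" id] zero
    unfolding id by simp_all
  have fold_q: "pair_lengths \<phi> (hook_pairs (bar_maya (set q))) + mset_set Pq =
      ?B \<phi> (set q) + ?B \<phi> (set q) + ?D (mset_set Pq)"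
    using bar_pair_lengths_fold[of "set q" \<phi>, OF _ zero(3) odd] unfolding Pq by simp
  have hooks: "pair_lengths id (hook_pairs (bar_maya (set lam))) =
      pair_lengths id (hook_pairs (bar_maya (set c))) + pair_lengths \<phi> (hook_pairs (bar_maya (set q)))"
    unfolding M c(2)
  proof (rule hook_pairs_\<phi>)
    show "maya_set (bar_maya (set q))" by (rule maya_set_bar_maya) simp
    show "charge (int d) (bar_maya (set q)) i = 0" for i
      unfolding q(2) M_def using charge_normalized[OF maya_set_bar_maya] d_pos by simp
  qed
  have double: "?D (parts lam) + ?D e + ?D e = ?D (parts c) + ?D (mset_set Pq)"
    using sym_diff by (metis image_mset_union)
  \<comment> \<open>The three folding identities, linked by \<open>hooks\<close>, give twice this
    equation once \<open>sym_diff\<close> and \<open>double\<close> have eliminated the multisets of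
    parts. Passing to multiplicities allows the division by 2.\<close>
  have main: "bar_lengths lam + e = bar_lengths c + ?B \<phi> (set q) + ?D e"
  proof (rule multiset_eqI)
    fix n
    note count_eq = arg_cong[where f = "\<lambda>X. count X n"]
    show "count (bar_lengths lam + e) n = count (bar_lengths c + ?B \<phi> (set q) + ?D e) n"
      using count_eq[OF fold_lam] count_eq[OF fold_c] count_eq[OF fold_q] count_eq[OF hooks]
        count_eq[OF double] count_eq[OF sym_diff]
      unfolding count_union by linarith
  qed
  have mb: "modified_bar_lengths d lam q = ?B \<phi> (set q)"
    unfolding modified_bar_lengths_eq[OF d_pos lam q(1)] \<phi> ..
  \<comment> \<open>Modified parts are among the modified bar lengths, so the difference in
    \<open>tilde_bar_lengths\<close> subtracts all of \<open>e\<close> without truncation.\<close>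
  have "mset_set Pq \<subseteq># ?B \<phi> (set q)"
    unfolding mb[symmetric] mp[symmetric] modified_bar_lengths_def modified_parts_def
    by (rule image_mset_subseteq_mono, rule subset_imp_msubset_mset_set) (use finite_bar_hooks in auto)
  then have "e \<subseteq># ?B \<phi> (set q)"
    unfolding e_def mp by (meson subset_mset.inf_le2 subset_mset.order_trans)
  then obtain X where X: "?B \<phi> (set q) = e + X" by (auto simp: mset_subset_eq_exists_conv)
  have "bar_lengths lam + e = bar_lengths c + (X + ?D e) + e"
    using main unfolding X by (simp only: add_ac)
  then have "bar_lengths lam = bar_lengths c + (X + ?D e)" by (rule add_right_imp_eq)
  then show ?thesis unfolding tilde_bar_lengths_def e_def[symmetric] mb X by simp
qed

end
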